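(* Let $a(n)$, $n\ge 0$, be the cubic partition function, defined by $\sum_{n=0}^{\infty} a(n)q^n = \prod_{n=1}^{\infty} \frac{1}{(1-q^n)(1-q^{2n})}$. Then, as $n \to \infty$, $$a(n) \sim \frac{e^{\pi\sqrt{n-\frac{1}{8}}}}{8\left(n-\frac{1}{8}\right)^{\frac{5}{4}}},$$ that is, the ratio of the two sides tends to $1$.
   Context: The cubic partition function $a(n)$ is the sequence of coefficients of the power series in $q$ given by $\sum_{n=0}^{\infty} a(n)q^n = \prod_{n=1}^{\infty} \frac{1}{(1-q^n)(1-q^{2n})}$ (as a formal power series, or for $|q|<1$). Its first values are $a(0)=1$, $a(1)=1$, $a(2)=3$, $a(3)=4$, $a(4)=9$. *)

theory Defs
  imports "HOL-Analysis.Analysis" "HOL-Library.Landau_Symbols"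
begin

(* The factor of the generating product with exponent n + 1: the infinite product below
   is indexed from 0, the mathematical one from 1. *)
definition cubic_factor :: "nat \<Rightarrow> real fps" where
  "cubic_factor n = inverse ((1 - fps_X ^ (n + 1)) * (1 - fps_X ^ (2 * (n + 1))))"

(* The infinite product is a limit in the metric space of formal power series; it exists
   by cubic_factor_has_prod. *)
definition cubic_partition_fps :: "real fps" where
  "cubic_partition_fps = (\<Prod>n. cubic_factor n)"

(* The coefficients are non-negative integers, taken here as real numbers. *)
definition cubic_partition :: "nat \<Rightarrow> real" where
  "cubic_partition n = fps_nth cubic_partition_fps n"

lemma cubic_factor_decomp:
  "\<exists>h. cubic_factor n = 1 + fps_X ^ (n + 1) * h"
proof -
  define Y :: "real fps" where "Y = fps_X ^ (n + 1)"
  define D where "D = (1 - Y) * (1 - Y * Y)"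
  have f: "cubic_factor n = inverse D"
    by (simp only: cubic_factor_def D_def Y_def power_add[symmetric] mult_2)
  have "fps_nth D 0 \<noteq> 0"
    by (simp add: D_def Y_def)
  hence 1: "inverse D * D = 1"
    by (rule inverse_mult_eq_1)
  have "inverse D = inverse D * D + inverse D * (1 - D)"
    by (simp add: algebra_simps)
  also have "1 - D = Y * (1 + Y - Y * Y)"
    by (simp add: D_def algebra_simps)
  finally have "inverse D = 1 + Y * (inverse D * (1 + Y - Y * Y))"
    by (simp add: 1 mult.left_commute)
  thus ?thesis unfolding f Y_def by blast
qed

lemma cubic_prod_stable:
  assumes "n \<le> N" "N \<le> M"
  shows "fps_nth (\<Prod>k\<le>M. cubic_factor k) n = fps_nth (\<Prod>k\<le>N. cubic_factor k) n"
  using assms(2)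
proof (induction M rule: dec_induct)
  case (step M)
  obtain h where h: "cubic_factor (Suc M) = 1 + fps_X ^ (Suc M + 1) * h"
    using cubic_factor_decomp by blast
  have "(\<Prod>k\<le>Suc M. cubic_factor k)
      = (\<Prod>k\<le>M. cubic_factor k) + fps_X ^ (Suc M + 1) * (h * (\<Prod>k\<le>M. cubic_factor k))"
    by (simp add: h algebra_simps)
  moreover have "n < Suc M + 1" using assms(1) step by simp
  ultimately show ?case
    using step by (simp only: fps_add_nth fps_X_power_mult_nth if_True)
qed simp

lemma cubic_factor_has_prod: "cubic_factor has_prod cubic_partition_fps"
proof -
  define L where "L = Abs_fps (\<lambda>n. fps_nth (\<Prod>k\<le>n. cubic_factor k) n)"
  have "(\<lambda>N. \<Prod>k\<le>N. cubic_factor k) \<longlonglongrightarrow> L"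
  proof (rule tendsto_fpsI)
    fix n
    show "\<forall>\<^sub>F N in sequentially. fps_nth (\<Prod>k\<le>N. cubic_factor k) n = fps_nth L n"
      using eventually_ge_at_top[of n]
    proof eventually_elim
      case (elim N)
      show ?case
        unfolding L_def by (simp only: fps_nth_Abs_fps cubic_prod_stable[OF order.refl elim])
    qed
  qed
  moreover have "fps_nth L 0 = 1"
    by (simp add: L_def cubic_factor_def)
  hence "L \<noteq> 0" by (metis fps_zero_nth zero_neq_one)
  ultimately have "raw_has_prod cubic_factor 0 L"
    unfolding raw_has_prod_def by simp
  hence *: "cubic_factor has_prod L"
    unfolding has_prod_def by blast
  show ?thesis
    unfolding cubic_partition_fps_def has_prod_unique[OF *, symmetric] by (rule *)
qed

end

theory Submission
  imports Defs "HOL-Probability.Probability" "HOL-Real_Asymp.Real_Asymp"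
begin

text \<open>
  The proof is the saddle point method in the form of a local central limit theorem. Put
  \<open>F z = (\<Sum>n. a n * z ^ n)\<close>. Cauchy's formula on the circle of radius \<open>exp (- t)\<close> gives

    \<open>2 * pi * a n * exp (- n * t) = \<integral> F (exp (- t + \<i> * \<theta>)) * exp (- \<i> * n * \<theta>) d\<theta>\<close>
    over \<open>\<bar>\<theta>\<bar> \<le> pi\<close>.

  With \<open>L z = (\<Sum>k\<ge>1. - ln (1 - z ^ k))\<close> one has \<open>F z = exp (L z + L (z ^ 2))\<close>, and expanding the
  logarithms turns \<open>L\<close> into the Lambert series with terms \<open>z ^ m / (1 - z ^ m) / m\<close>. Since
  \<open>1 / (exp s - 1)\<close> behaves like \<open>1 / s\<close>, the leading term of \<open>L (exp (- s))\<close> is \<open>pi\<^sup>2 / (6 * s)\<close> and that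
  of \<open>ln (F (exp (- s)))\<close> is \<open>pi\<^sup>2 / (4 * s)\<close>. Hence \<open>n * t + pi\<^sup>2 / (4 * t)\<close> has to be minimised, and
  the saddle point is \<open>t = pi / (2 * sqrt n)\<close>, where the minimum is \<open>pi * sqrt n\<close>. The width of the
  peak is \<open>t powr (3 / 2)\<close>: after the substitution \<open>\<theta> = t powr (3 / 2) * u\<close> the integrand divided
  by \<open>F (exp (- t))\<close> tends to the Gaussian \<open>exp (- (pi\<^sup>2 * u\<^sup>2 / 4))\<close>. Three estimates carry the proof.

  \<^item> Pointwise convergence (\<open>scaled_integrand_tendsto\<close>). The function \<open>1 / (exp s - 1) - 1 / s\<close> has a
    derivative of order at most \<open>1 / (1 + \<bar>s\<bar>\<^sup>2)\<close> in the sector \<open>\<bar>Im s\<bar> \<le> Re s\<close>. Summed over the Lambert series,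
    this says that \<open>L (exp (- s)) - L (exp (- t))\<close> differs from \<open>pi\<^sup>2 / 6 * (1 / s - 1 / t)\<close> by
    \<open>O (\<bar>\<theta>\<bar> / t)\<close> for \<open>s = t - \<i> * \<theta>\<close>, which is \<open>O (sqrt t)\<close> on the scale of the peak.

  \<^item> Domination (\<open>norm_scaled_integrand_le\<close>). On each circle around 0, every term of the Lambert
    series has its largest real part on the positive axis, so \<open>\<bar>F z\<bar> / F \<bar>z\<bar>\<close> is bounded by the contribution of the term \<open>m = 1\<close>
    alone. That contribution already decays like a power of \<open>u\<close>, uniformly in \<open>t\<close>.

  \<^item> The value on the real axis (\<open>log_euler_real_asymptotics\<close>), including the constant:
    \<open>L (exp (- t)) = pi\<^sup>2 / (6 * t) + ln t / 2 - ln (2 * pi) / 2 + o(1)\<close>. The logarithmic singularity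
    of \<open>- ln (1 - exp (- x))\<close> at 0 is removed by subtracting \<open>ln (1 + 1 / x\<^sup>2) / 2\<close>, whose sum over the
    multiples of \<open>t\<close> is known exactly from the product formula for the sine. What is left is
    smooth, and the trapezoidal rule approximates its sum with error \<open>O (t)\<close>.

  Multiplying the value at the saddle point by the Gaussian integral \<open>2 / sqrt pi\<close> gives the claim;
  the shift from \<open>n\<close> to \<open>n - 1 / 8\<close> changes the right-hand side by a factor tending to 1.
\<close>

section \<open>The generating function as the exponential of a Lambert series\<close>

text \<open>
  Fubini for double series with a product majorant. The partial sums over \<open>k\<close> may be taken inside
  the sum over \<open>m\<close>, and Tannery's theorem then passes to the limit.
\<close>

lemma suminf_swap_dominated:
  fixes f :: "nat \<Rightarrow> nat \<Rightarrow> 'a :: {real_normed_algebra, banach}"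
  assumes bound: "\<And>k m. norm (f k m) \<le> A k * B m"
    and A: "summable A" "\<And>k. A k \<ge> 0" and B: "summable B" "\<And>m. B m \<ge> 0"
  shows "(\<lambda>k. \<Sum>m. f k m) sums (\<Sum>m. \<Sum>k. f k m)"
proof -
  have sum_m: "summable (f k)" for k
    by (rule summable_comparison_test'[where g = "\<lambda>m. A k * B m" and N = 0])
      (use bound B in \<open>auto intro: summable_mult\<close>)
  have sum_k: "summable (\<lambda>k. f k m)" for m
    by (rule summable_comparison_test'[where g = "\<lambda>k. A k * B m" and N = 0])
      (use bound A in \<open>auto intro: summable_mult2\<close>)
  have "norm (\<Sum>k<n. f k m) \<le> suminf A * B m" for n m
  proof -
    have "norm (\<Sum>k<n. f k m) \<le> (\<Sum>k<n. A k * B m)"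
      by (rule sum_norm_le) (rule bound)
    also have "\<dots> = (\<Sum>k<n. A k) * B m" by (simp add: sum_distrib_right)
    also have "\<dots> \<le> suminf A * B m"
      by (intro mult_right_mono sum_le_suminf) (use A B in auto)
    finally show ?thesis .
  qed
  then have "((\<lambda>n. \<Sum>m. \<Sum>k<n. f k m) \<longlongrightarrow> (\<Sum>m. \<Sum>k. f k m)) sequentially"
    by (intro tannerys_theorem[where M = "\<lambda>m. suminf A * B m", THEN conjunct2, THEN conjunct2])
      (auto intro!: summable_mult B summable_LIMSEQ sum_k always_eventually)
  moreover have "(\<Sum>m. \<Sum>k<n. f k m) = (\<Sum>k<n. \<Sum>m. f k m)" for n
    by (rule suminf_sum) (rule sum_m)
  ultimately show ?thesis by (simp add: sums_def)
qed

text \<open>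
  The Lambert series of \<open>- ln (\<Prod>k\<ge>1. (1 - z ^ k))\<close>. It is the more useful form of this logarithm,
  because the \<open>m\<close>-th term is a value of the single function \<open>1 / (exp s - 1)\<close>, divided by \<open>m\<close>.
\<close>

definition log_euler :: "complex \<Rightarrow> complex" where
  "log_euler z = (\<Sum>m. z ^ Suc m / (1 - z ^ Suc m) / of_nat (Suc m))"

lemma norm_power_Suc_less_1:
  fixes z :: "'a :: real_normed_div_algebra"
  assumes "norm z < 1" shows "norm (z ^ Suc k) < 1"
  using power_le_one[of "norm z" k] assms
  by (simp add: norm_mult norm_power) (metis less_eq_real_def mult_left_le norm_ge_zero order_le_less_trans)

lemma minus_Ln_sums:
  assumes "norm (w :: complex) < 1"
  shows "(\<lambda>m. w ^ Suc m / of_nat (Suc m)) sums (- Ln (1 - w))"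
proof -
  have "(\<lambda>n. - (- ((- (- w)) ^ n) / of_nat n)) sums (- ln (1 + (- w)))"
    by (intro sums_minus Ln_series') (use assms in simp)
  then have "(\<lambda>n. w ^ n / of_nat n) sums (- Ln (1 - w))" by simp
  then show ?thesis
    by (subst sums_Suc_iff) simp
qed

lemma power_over_one_minus_sums:
  assumes "norm (z :: complex) < 1"
  shows "(\<lambda>k. (z ^ Suc k) ^ Suc m / of_nat (Suc m)) sums (z ^ Suc m / (1 - z ^ Suc m) / of_nat (Suc m))"
proof -
  have "(\<lambda>k. z ^ Suc m / of_nat (Suc m) * (z ^ Suc m) ^ k)
      sums (z ^ Suc m / of_nat (Suc m) * (1 / (1 - z ^ Suc m)))"
    by (intro sums_mult geometric_sums norm_power_Suc_less_1 assms)
  moreover have "(z ^ Suc k) ^ Suc m = z ^ Suc m * (z ^ Suc m) ^ k" for k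
    by (simp only: power_mult [symmetric] power_add [symmetric]) (simp add: algebra_simps)
  ultimately show ?thesis by (simp del: power_Suc of_nat_Suc add: mult.commute)
qed

text \<open>
  Both sides come from the double series with terms \<open>z ^ (k * m) / m\<close>, \<open>k, m \<ge> 1\<close>: summing over \<open>m\<close>
  first yields a logarithm, summing over \<open>k\<close> first a geometric series.
\<close>

lemma minus_Ln_sums_log_euler:
  assumes "norm z < 1"
  shows "(\<lambda>k. - Ln (1 - z ^ Suc k)) sums log_euler z"
proof -
  let ?f = "\<lambda>k m. (z ^ Suc k) ^ Suc m / of_nat (Suc m) :: complex"
  have "norm (?f k m) \<le> norm z ^ k * norm z ^ m" for k m
  proof -
    have "norm (?f k m) = norm z ^ (Suc k * Suc m) / real (Suc m)"
      by (simp only: norm_divide norm_power norm_of_nat power_mult [symmetric])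
    also have "\<dots> \<le> norm z ^ (Suc k * Suc m) / 1"
      by (intro divide_left_mono) auto
    also have "\<dots> \<le> norm z ^ (k + m)"
      using assms by (simp only: div_by_1) (rule power_decreasing, auto)
    finally show ?thesis by (simp only: power_add)
  qed
  then have "(\<lambda>k. \<Sum>m. ?f k m) sums (\<Sum>m. \<Sum>k. ?f k m)"
    by (rule suminf_swap_dominated) (use assms in \<open>auto intro: summable_geometric\<close>)
  moreover have "(\<Sum>m. ?f k m) = - Ln (1 - z ^ Suc k)" for k
    by (rule sums_unique [symmetric], rule minus_Ln_sums, rule norm_power_Suc_less_1, rule assms)
  moreover have "(\<Sum>k. ?f k m) = z ^ Suc m / (1 - z ^ Suc m) / of_nat (Suc m)" for m
    by (rule sums_unique [symmetric], rule power_over_one_minus_sums, rule assms)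
  ultimately show ?thesis by (simp add: log_euler_def)
qed

text \<open>
  Evaluation of a real power series at a complex point. For nonnegative coefficients absolute
  convergence at \<open>z\<close> is convergence at \<open>\<bar>z\<bar>\<close>, and so the property is closed under products.
\<close>

definition nonneg_fps_sums :: "real fps \<Rightarrow> complex \<Rightarrow> complex \<Rightarrow> bool" where
  "nonneg_fps_sums f z A \<longleftrightarrow> (\<forall>n. fps_nth f n \<ge> 0) \<and> summable (\<lambda>n. fps_nth f n * norm z ^ n)
     \<and> (\<lambda>n. of_real (fps_nth f n) * z ^ n) sums A"

lemma nonneg_fps_sums_mult:
  assumes f: "nonneg_fps_sums f z A" and g: "nonneg_fps_sums g z B"
  shows "nonneg_fps_sums (f * g) z (A * B)"
proof -
  have norms: "summable (\<lambda>n. norm (of_real (fps_nth h n) * w ^ n))"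
    if "nonneg_fps_sums h z C" "norm w = norm z" for h C and w :: complex
    using that by (simp add: nonneg_fps_sums_def norm_mult norm_power)
  have normsr: "summable (\<lambda>n. norm (fps_nth h n * norm z ^ n))" if "nonneg_fps_sums h z C" for h C
    using that by (simp add: nonneg_fps_sums_def abs_mult)
  have "(\<lambda>k. \<Sum>i\<le>k. (of_real (fps_nth f i) * z ^ i) * (of_real (fps_nth g (k - i)) * z ^ (k - i)))
      sums ((\<Sum>k. of_real (fps_nth f k) * z ^ k) * (\<Sum>k. of_real (fps_nth g k) * z ^ k))"
    by (intro Cauchy_product_sums norms[OF f] norms[OF g] refl)
  moreover have "(\<Sum>i\<le>k. (of_real (fps_nth f i) * z ^ i) * (of_real (fps_nth g (k - i)) * z ^ (k - i)))
      = of_real (fps_nth (f * g) k) * z ^ k" for k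
    by (simp add: fps_mult_nth atLeast0AtMost sum_distrib_right)
       (rule sum.cong, simp_all add: power_add [symmetric] mult_ac)
  moreover have "summable (\<lambda>k. \<Sum>i\<le>k. (fps_nth f i * norm z ^ i) * (fps_nth g (k - i) * norm z ^ (k - i)))"
    by (intro summable_Cauchy_product normsr[OF f] normsr[OF g])
  moreover have "(\<Sum>i\<le>k. (fps_nth f i * norm z ^ i) * (fps_nth g (k - i) * norm z ^ (k - i)))
      = fps_nth (f * g) k * norm z ^ k" for k
    by (simp add: fps_mult_nth atLeast0AtMost sum_distrib_right)
       (rule sum.cong, simp_all add: power_add [symmetric] mult_ac)
  moreover have "fps_nth (f * g) n \<ge> 0" for n
    unfolding fps_mult_nth using f g by (intro sum_nonneg) (auto simp: nonneg_fps_sums_def)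
  moreover have "(\<Sum>k. of_real (fps_nth f k) * z ^ k) = A" "(\<Sum>k. of_real (fps_nth g k) * z ^ k) = B"
    using f g by (auto simp: nonneg_fps_sums_def sums_iff)
  ultimately show ?thesis
    by (simp add: nonneg_fps_sums_def)
qed

lemma nonneg_fps_sums_prod:
  assumes "\<And>k. k \<in> I \<Longrightarrow> nonneg_fps_sums (f k) z (A k)"
  shows "nonneg_fps_sums (\<Prod>k\<in>I. f k) z (\<Prod>k\<in>I. A k)"
proof -
  have 1: "nonneg_fps_sums 1 z 1"
    using sums_If_finite_set[of "{0}" "\<lambda>n. z ^ n"] summable_If_finite_set[of "{0}" "\<lambda>n. norm z ^ n"]
    by (auto simp: nonneg_fps_sums_def fps_one_nth if_distrib[of "\<lambda>x. x * _"] if_distrib[of of_real] cong: if_cong)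
  show ?thesis
    using assms by (induction I rule: infinite_finite_induct) (auto intro: 1 nonneg_fps_sums_mult)
qed

lemma nonneg_fps_sums_geometric:
  assumes "m > 0" "norm z < 1"
  shows "nonneg_fps_sums (inverse (1 - fps_X ^ m)) z (1 / (1 - z ^ m))"
proof -
  define h :: "real fps" where "h = Abs_fps (\<lambda>n. if m dvd n then 1 else 0)"
  have "(1 - fps_X ^ m) * h = 1"
  proof (rule fps_ext)
    fix n show "fps_nth ((1 - fps_X ^ m) * h) n = fps_nth 1 n"
      using assms(1) by (auto simp: h_def algebra_simps fps_X_power_mult_nth fps_one_nth
          dvd_minus_self dest: dvd_imp_le)
  qed
  then have h: "inverse (1 - fps_X ^ m) = h"
    using assms(1) by (metis fps_inverse_unique)
  have inj: "strict_mono ((*) m)" using assms(1) by (simp add: strict_mono_def)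
  have outside: "fps_nth h n = 0" if "n \<notin> range ((*) m)" for n
    using that by (auto simp: h_def)
  have gs: "(\<lambda>k. (z ^ m) ^ k) sums (1 / (1 - z ^ m))"
    "summable (\<lambda>k. (norm z ^ m) ^ k)"
    using norm_power_Suc_less_1[OF assms(2), of "m - 1"] assms(1)
    by (auto intro!: geometric_sums summable_geometric simp: norm_power)
  have "(\<lambda>n. of_real (fps_nth h n) * z ^ n) sums (1 / (1 - z ^ m))"
    by (subst sums_mono_reindex[OF inj, symmetric])
       (use gs outside in \<open>auto simp: h_def power_mult\<close>)
  moreover have "summable (\<lambda>n. fps_nth h n * norm z ^ n)"
    by (subst summable_mono_reindex[OF inj, symmetric])
       (use gs outside in \<open>auto simp: h_def power_mult\<close>)
  ultimately show ?thesis by (simp add: h nonneg_fps_sums_def) (simp add: h_def)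
qed

lemma nonneg_fps_sums_cubic_factor:
  assumes "norm z < 1"
  shows "nonneg_fps_sums (cubic_factor k) z (1 / (1 - z ^ Suc k) * (1 / (1 - (z ^ 2) ^ Suc k)))"
proof -
  have "cubic_factor k = inverse (1 - fps_X ^ (k + 1)) * inverse (1 - fps_X ^ (2 * (k + 1)))"
    unfolding cubic_factor_def by (rule fps_inverse_mult)
  moreover have "nonneg_fps_sums (inverse (1 - fps_X ^ (k + 1)) * inverse (1 - fps_X ^ (2 * (k + 1)))) z
    (1 / (1 - z ^ (k + 1)) * (1 / (1 - z ^ (2 * (k + 1)))))"
    by (intro nonneg_fps_sums_mult nonneg_fps_sums_geometric assms) auto
  moreover have "z ^ (2 * (k + 1)) = (z ^ 2) ^ Suc k"
    by (simp only: power_mult Suc_eq_plus1)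
  ultimately show ?thesis by (simp only: Suc_eq_plus1)
qed

definition cubic_gf :: "complex \<Rightarrow> complex" where
  "cubic_gf z = exp (log_euler z + log_euler (z ^ 2))"

text \<open>
  Convergence of the analytic product; its finite partial products are the values of the finite
  partial products of formal power series.
\<close>

lemma cubic_partial_products_tendsto:
  assumes "norm z < 1"
  shows "(\<lambda>N. \<Prod>k\<le>N. 1 / (1 - z ^ Suc k) * (1 / (1 - (z ^ 2) ^ Suc k))) \<longlonglongrightarrow> cubic_gf z"
proof -
  have z2: "norm (z ^ 2) < 1"
    using norm_power_Suc_less_1[OF assms, of 1] by (simp add: power2_eq_square)
  have "(\<lambda>k. - Ln (1 - z ^ Suc k) + - Ln (1 - (z ^ 2) ^ Suc k)) sums (log_euler z + log_euler (z ^ 2))"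
    by (intro sums_add minus_Ln_sums_log_euler assms z2)
  then have "(\<lambda>N. exp (\<Sum>k\<le>N. - Ln (1 - z ^ Suc k) + - Ln (1 - (z ^ 2) ^ Suc k))) \<longlonglongrightarrow> cubic_gf z"
    unfolding sums_def_le cubic_gf_def by (intro tendsto_exp)
  moreover have e: "exp (- Ln (1 - w ^ Suc k)) = 1 / (1 - w ^ Suc k)" if "norm w < 1" for w :: complex and k
  proof -
    have "1 - w ^ Suc k \<noteq> 0" using norm_power_Suc_less_1[OF that, of k] by auto
    then show ?thesis by (simp add: exp_minus exp_Ln divide_inverse del: power_Suc)
  qed
  moreover have "exp (\<Sum>k\<le>N. - Ln (1 - z ^ Suc k) + - Ln (1 - (z ^ 2) ^ Suc k))
      = (\<Prod>k\<le>N. 1 / (1 - z ^ Suc k) * (1 / (1 - (z ^ 2) ^ Suc k)))" for N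
    by (simp only: exp_sum finite_atMost exp_add e[OF assms] e[OF z2])
  ultimately show ?thesis by (simp only:)
qed

lemma cubic_partition_eq:
  assumes "n \<le> N"
  shows "fps_nth (\<Prod>k\<le>N. cubic_factor k) n = cubic_partition n"
proof -
  have "(\<lambda>N. fps_nth (\<Prod>k\<le>N. cubic_factor k) n) \<longlonglongrightarrow> cubic_partition n"
    using has_prod_imp_tendsto[OF cubic_factor_has_prod]
    by (auto simp: tendsto_fps_iff cubic_partition_def intro: tendsto_eventually)
  moreover have "(\<lambda>N. fps_nth (\<Prod>k\<le>N. cubic_factor k) n) \<longlonglongrightarrow> fps_nth (\<Prod>k\<le>N. cubic_factor k) n"
    by (rule tendsto_eventually, rule eventually_mono[OF eventually_ge_at_top[of N]])
       (rule cubic_prod_stable[OF assms])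
  ultimately show ?thesis by (rule LIMSEQ_unique [symmetric])
qed

lemma partial_product_nonneg:
  "fps_nth (\<Prod>k\<le>N. cubic_factor k) n \<ge> 0"
  using nonneg_fps_sums_prod[OF nonneg_fps_sums_cubic_factor[of 0], where I = "{..N}"]
  by (auto simp: nonneg_fps_sums_def)

text \<open>
  A further factor has constant coefficient 1 and nonnegative coefficients, so the coefficients of
  the partial products increase until they become stationary.
\<close>

lemma partial_product_le:
  "fps_nth (\<Prod>k\<le>N. cubic_factor k) n \<le> cubic_partition n"
proof -
  have one: "fps_nth (cubic_factor k) 0 = 1" for k by (simp add: cubic_factor_def)
  have step: "fps_nth (\<Prod>k\<le>M. cubic_factor k) n \<le> fps_nth (\<Prod>k\<le>Suc M. cubic_factor k) n" for M
  proof -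
    have "fps_nth (\<Prod>k\<le>M. cubic_factor k) n * fps_nth (cubic_factor (Suc M)) (n - n)
      \<le> (\<Sum>i=0..n. fps_nth (\<Prod>k\<le>M. cubic_factor k) i * fps_nth (cubic_factor (Suc M)) (n - i))"
      using nonneg_fps_sums_cubic_factor[of 0 "Suc M"] partial_product_nonneg[of M]
      by (intro member_le_sum mult_nonneg_nonneg) (auto simp: nonneg_fps_sums_def)
    then show ?thesis by (simp add: fps_mult_nth one)
  qed
  have "fps_nth (\<Prod>k\<le>N. cubic_factor k) n \<le> fps_nth (\<Prod>k\<le>max n N. cubic_factor k) n"
    by (rule lift_Suc_mono_le[where f = "\<lambda>N. fps_nth (\<Prod>k\<le>N. cubic_factor k) n"]) (use step in auto)
  then show ?thesis by (simp add: cubic_partition_eq)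
qed

lemma cubic_partition_nonneg: "cubic_partition n \<ge> 0"
  using partial_product_nonneg[of n n] by (simp add: cubic_partition_eq)

text \<open>
  The first \<open>N\<close> terms of the series agree with those of the \<open>N\<close>-th partial product, and the
  values of the partial products are bounded because they converge.
\<close>

lemma cubic_partition_summable:
  assumes "0 \<le> r" "r < 1"
  shows "summable (\<lambda>n. cubic_partition n * r ^ n)"
proof -
  define z where "z = complex_of_real r"
  have z: "norm z < 1" using assms by (simp add: z_def)
  define Q where "Q N = (\<Prod>k\<le>N. 1 / (1 - z ^ Suc k) * (1 / (1 - (z ^ 2) ^ Suc k)))" for N
  have sums: "nonneg_fps_sums (\<Prod>k\<le>N. cubic_factor k) z (Q N)" for N
    unfolding Q_def by (intro nonneg_fps_sums_prod nonneg_fps_sums_cubic_factor z)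
  have "convergent Q" using cubic_partial_products_tendsto[OF z] unfolding Q_def convergent_def by blast
  then obtain C where C: "\<And>N. norm (Q N) \<le> C"
    using convergent_imp_Bseq BseqE by metis
  have "(\<Sum>n\<le>N. norm (cubic_partition n * r ^ n)) \<le> C" for N
  proof -
    have s: "summable (\<lambda>n. fps_nth (\<Prod>k\<le>N. cubic_factor k) n * r ^ n)"
      using sums[of N] assms by (simp add: nonneg_fps_sums_def z_def)
    have "(\<Sum>n\<le>N. norm (cubic_partition n * r ^ n)) = (\<Sum>n\<le>N. fps_nth (\<Prod>k\<le>N. cubic_factor k) n * r ^ n)"
      using assms by (intro sum.cong) (auto simp: cubic_partition_eq cubic_partition_nonneg abs_mult)
    also have "\<dots> \<le> (\<Sum>n. fps_nth (\<Prod>k\<le>N. cubic_factor k) n * r ^ n)"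
      using assms by (intro sum_le_suminf s) (auto intro: partial_product_nonneg mult_nonneg_nonneg)
    also have "\<dots> \<le> norm (Q N)"
    proof -
      have "(\<lambda>n. complex_of_real (fps_nth (\<Prod>k\<le>N. cubic_factor k) n * r ^ n)) sums Q N"
        using sums[of N] by (simp add: nonneg_fps_sums_def z_def)
      moreover have "(\<lambda>n. complex_of_real (fps_nth (\<Prod>k\<le>N. cubic_factor k) n * r ^ n)) sums
         of_real (\<Sum>n. fps_nth (\<Prod>k\<le>N. cubic_factor k) n * r ^ n)"
        using s by (intro sums_of_real summable_sums)
      ultimately have "Q N = of_real (\<Sum>n. fps_nth (\<Prod>k\<le>N. cubic_factor k) n * r ^ n)"
        by (rule sums_unique2)
      then show ?thesis by simp
    qed
    also have "\<dots> \<le> C" by (rule C)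
    finally show ?thesis .
  qed
  then have "summable (\<lambda>n. norm (cubic_partition n * r ^ n))"
    by (intro bounded_imp_summable) auto
  then show ?thesis by (rule summable_norm_cancel)
qed

text \<open>
  The coefficients of the partial products converge and are dominated by \<open>cubic_partition\<close>, so
  Tannery's theorem carries the product formula from the finite products to the limit.
\<close>

lemma cubic_partition_sums_gf:
  assumes "norm z < 1"
  shows "(\<lambda>n. of_real (cubic_partition n) * z ^ n) sums cubic_gf z"
proof -
  let ?p = "\<lambda>N n. fps_nth (\<Prod>k\<le>N. cubic_factor k) n"
  have dom: "summable (\<lambda>n. cubic_partition n * norm z ^ n)"
    by (intro cubic_partition_summable assms) auto
  have "(\<lambda>N. \<Sum>n. of_real (?p N n) * z ^ n) \<longlonglongrightarrow> (\<Sum>n. of_real (cubic_partition n) * z ^ n)"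
  proof (intro tannerys_theorem[where M = "\<lambda>n. cubic_partition n * norm z ^ n", THEN conjunct2, THEN conjunct2] dom)
    show "(\<lambda>N. of_real (?p N n) * z ^ n) \<longlonglongrightarrow> of_real (cubic_partition n) * z ^ n" for n
      by (rule tendsto_eventually, rule eventually_mono[OF eventually_ge_at_top[of n]])
         (simp add: cubic_partition_eq)
    show "\<forall>\<^sub>F (n, N) in at_top \<times>\<^sub>F at_top. norm (of_real (?p N n) * z ^ n) \<le> cubic_partition n * norm z ^ n"
      by (intro always_eventually)
         (auto simp: norm_mult norm_power partial_product_nonneg intro!: mult_right_mono partial_product_le)
  qed auto
  moreover have "(\<Sum>n. of_real (?p N n) * z ^ n) = (\<Prod>k\<le>N. 1 / (1 - z ^ Suc k) * (1 / (1 - (z ^ 2) ^ Suc k)))" for N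
    using nonneg_fps_sums_prod[OF nonneg_fps_sums_cubic_factor[OF assms], where I = "{..N}"]
    by (auto simp: nonneg_fps_sums_def sums_iff)
  ultimately have "(\<Sum>n. of_real (cubic_partition n) * z ^ n) = cubic_gf z"
    using cubic_partial_products_tendsto[OF assms] LIMSEQ_unique by fastforce
  moreover have "summable (\<lambda>n. of_real (cubic_partition n) * z ^ n)"
    by (rule summable_norm_cancel) (use dom cubic_partition_nonneg in \<open>simp add: norm_mult norm_power\<close>)
  ultimately show ?thesis by (simp add: sums_iff)
qed

section \<open>The Bose function near the real axis\<close>

lemma norm_sinh_ge: "norm (sinh w) \<ge> sinh (Re w)" for w :: complex
proof -
  have "2 * sinh (Re w) = norm (exp w) - norm (exp (- w))"
    by (simp add: sinh_def)
  also have "\<dots> \<le> norm (exp w - exp (- w))" by (rule norm_triangle_ineq2)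
  also have "\<dots> = 2 * norm (sinh w)" by (simp add: sinh_def)
  finally show ?thesis by simp
qed

lemma norm_sinh_minus_self_le:
  fixes w :: complex
  assumes "norm w \<le> 1"
  shows "norm (sinh w - w) \<le> 3 / 2 * norm w ^ 3"
proof -
  have T: "norm (exp v - (1 + v + v\<^sup>2 / 2)) \<le> 3 / 2 * norm w ^ 3" if "norm v = norm w" for v :: complex
  proof -
    have "norm (exp v - (\<Sum>i\<le>2. v ^ i / fact i)) \<le> exp (norm v) * norm v ^ Suc 2 / fact 2"
      by (rule Taylor_exp_field)
    also have "\<dots> \<le> 3 * norm w ^ 3 / 2"
    proof -
      have "exp (norm v) \<le> exp 1" using assms that by simp
      also have "\<dots> \<le> (3 :: real)" by (rule exp_le)
      finally show ?thesis unfolding that by (simp add: numeral_3_eq_3 [symmetric] mult_right_mono)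
    qed
    finally show ?thesis by (simp add: numeral_2_eq_2)
  qed
  have "2 * (sinh w - w) = (exp w - (1 + w + w\<^sup>2 / 2)) - (exp (- w) - (1 + (- w) + (- w)\<^sup>2 / 2))"
    by (simp add: sinh_def scaleR_conv_of_real algebra_simps)
  then have "2 * norm (sinh w - w) \<le> norm (exp w - (1 + w + w\<^sup>2 / 2)) + norm (exp (- w) - (1 + (- w) + (- w)\<^sup>2 / 2))"
    by (metis norm_mult norm_numeral norm_triangle_ineq4)
  also have "\<dots> \<le> 3 / 2 * norm w ^ 3 + 3 / 2 * norm w ^ 3"
    by (intro add_mono T) auto
  finally show ?thesis by simp
qed

lemma norm_le_2_Re_squared:
  fixes w :: complex
  assumes "\<bar>Im w\<bar> \<le> Re w"
  shows "norm w ^ 2 \<le> 2 * Re w ^ 2"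
  using abs_le_square_iff[of "Im w" "Re w"] assms by (simp add: cmod_power2)

text \<open>
  The double poles at the origin cancel. Near 0 the bound comes from \<open>sinh w - w = O (\<bar>w\<bar> ^ 3)\<close>. Far
  from 0 each of the two terms is small by itself, since \<open>\<bar>sinh w\<bar> \<ge> sinh (Re w) \<ge> Re w\<close> and \<open>Re w\<close> is
  comparable with \<open>\<bar>w\<bar>\<close> in the sector.
\<close>

lemma inverse_sinh_squared_bound:
  fixes w :: complex
  assumes w: "0 < Re w" "\<bar>Im w\<bar> \<le> Re w"
  shows "norm (1 / w\<^sup>2 - 1 / (sinh w)\<^sup>2) \<le> 21 / (1 + norm w ^ 2)"
proof -
  define r where "r = norm w"
  have r: "r > 0" using w by (auto simp: r_def)
  have low: "norm (sinh w) ^ 2 \<ge> r ^ 2 / 2"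
  proof -
    have "Re w \<le> norm (sinh w)"
      using norm_sinh_ge[of w] real_le_x_sinh[of "Re w"] w by (simp add: sinh_def exp_minus)
    then have "Re w ^ 2 \<le> norm (sinh w) ^ 2" using w by (intro power_mono) auto
    then show ?thesis using norm_le_2_Re_squared[OF w(2)] by (simp add: r_def)
  qed
  have "(sinh w)\<^sup>2 \<noteq> 0" using low r by auto
  have n0: "sinh w \<noteq> 0" "w \<noteq> 0" using \<open>(sinh w)\<^sup>2 \<noteq> 0\<close> r by (auto simp: r_def)
  have far: "norm (1 / w\<^sup>2 - 1 / (sinh w)\<^sup>2) \<le> 3 / r ^ 2"
  proof -
    have "norm (1 / w\<^sup>2 - 1 / (sinh w)\<^sup>2) \<le> 1 / r ^ 2 + 1 / norm (sinh w) ^ 2"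
      using norm_triangle_ineq4[of "1 / w\<^sup>2" "1 / (sinh w)\<^sup>2"] by (simp add: r_def norm_divide norm_power)
    also have "\<dots> \<le> 1 / r ^ 2 + 1 / (r ^ 2 / 2)"
      using low r \<open>sinh w \<noteq> 0\<close> by (intro add_mono divide_left_mono) auto
    finally show ?thesis by simp
  qed
  show ?thesis
  proof (cases "r \<le> 1")
    case True
    have d: "norm (sinh w - w) \<le> 3 / 2 * r ^ 3"
      using norm_sinh_minus_self_le[of w] True by (simp add: r_def)
    have "norm (sinh w + w) \<le> norm (sinh w - w) + 2 * r"
      using norm_triangle_ineq[of "sinh w - w" "2 * w"] by (simp add: r_def norm_mult algebra_simps)
    also have "\<dots> \<le> 3 / 2 * r + 2 * r"
      using d power_decreasing[of 1 3 r] True r by simp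
    finally have s: "norm (sinh w + w) \<le> 7 / 2 * r" by simp
    have "1 / w\<^sup>2 - 1 / (sinh w)\<^sup>2 = (sinh w - w) * (sinh w + w) / (w\<^sup>2 * (sinh w)\<^sup>2)"
      using n0 by (simp add: field_simps power2_eq_square)
    then have "norm (1 / w\<^sup>2 - 1 / (sinh w)\<^sup>2)
        = norm (sinh w - w) * norm (sinh w + w) / (r ^ 2 * norm (sinh w) ^ 2)"
      by (simp add: norm_divide norm_mult norm_power r_def)
    also have "\<dots> \<le> (3 / 2 * r ^ 3) * (7 / 2 * r) / (r ^ 2 * (r ^ 2 / 2))"
      using low r d s by (intro frac_le mult_mono mult_left_mono) auto
    also have "\<dots> = 21 / 2" using r by (simp add: field_simps power2_eq_square power3_eq_cube)
    also have "\<dots> \<le> 21 / (1 + r ^ 2)"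
      using divide_left_mono[of "1 + r\<^sup>2" 2 "21 :: real"] True r power_le_one[of r 2]
      by (simp add: add_pos_nonneg)
    finally show ?thesis by (simp add: r_def)
  next
    case False
    then have "1 \<le> r ^ 2" by simp
    then have "3 * (1 + r ^ 2) \<le> 21 * r ^ 2" by simp
    then have "3 / r ^ 2 \<le> 21 / (1 + r ^ 2)"
      using \<open>1 \<le> r ^ 2\<close> by (subst frac_le_eq) (auto intro!: divide_nonpos_pos mult_pos_pos add_pos_nonneg)
    with far show ?thesis by (simp add: r_def)
  qed
qed

text \<open>
  The Bose--Einstein function. It is the generating function of the Lambert series:
  \<open>z ^ m / (1 - z ^ m) = bose (m * s)\<close> for \<open>z = exp (- s)\<close>.
\<close>

definition bose :: "'a :: {real_normed_field, banach} \<Rightarrow> 'a" where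
  "bose z = 1 / (exp z - 1)"

lemma exp_kernel_eq_inverse_sinh_squared:
  fixes z :: complex
  shows "exp z / (exp z - 1)\<^sup>2 = 1 / (4 * (sinh (z / 2))\<^sup>2)"
proof -
  define u where "u = exp (z / 2)"
  have u: "exp z = u\<^sup>2" "u \<noteq> 0"
    using exp_double[of "z / 2"] by (simp_all add: u_def)
  have S: "sinh (z / 2) = (u - inverse u) / 2"
    unfolding sinh_field_def u_def exp_minus ..
  have "u * (2 * sinh (z / 2)) = u * (u - inverse u)" unfolding S by simp
  also have "\<dots> = exp z - 1" using u by (simp add: right_diff_distrib power2_eq_square)
  finally have "exp z - 1 = u * (2 * sinh (z / 2))" ..
  then have e: "(exp z - 1)\<^sup>2 = exp z * (4 * (sinh (z / 2))\<^sup>2)"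
    by (simp only: u(1) power_mult_distrib) simp
  show ?thesis unfolding e using exp_not_eq_zero[of z] by (simp del: exp_not_eq_zero)
qed

text \<open>
  The left-hand side is the derivative of \<open>bose z - 1 / z\<close>.
\<close>

lemma bose_deriv_bound:
  fixes z :: complex
  assumes z: "0 < Re z" "\<bar>Im z\<bar> \<le> Re z"
  shows "norm (1 / z\<^sup>2 - exp z / (exp z - 1)\<^sup>2) \<le> 21 / (1 + norm z ^ 2)"
proof -
  have "norm (1 / (z / 2)\<^sup>2 - 1 / (sinh (z / 2))\<^sup>2) \<le> 21 / (1 + norm (z / 2) ^ 2)"
    using z by (intro inverse_sinh_squared_bound) auto
  moreover have "1 / z\<^sup>2 - exp z / (exp z - 1)\<^sup>2 = (1 / (z / 2)\<^sup>2 - 1 / (sinh (z / 2))\<^sup>2) / 4"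
    unfolding exp_kernel_eq_inverse_sinh_squared by (simp add: field_simps)
  then have "norm (1 / z\<^sup>2 - exp z / (exp z - 1)\<^sup>2) = norm (1 / (z / 2)\<^sup>2 - 1 / (sinh (z / 2))\<^sup>2) / 4"
    by (simp only: norm_divide norm_numeral)
  moreover have "norm (z / 2) ^ 2 = norm z ^ 2 / 4"
    by (simp add: norm_divide power_divide)
  ultimately have "norm (1 / z\<^sup>2 - exp z / (exp z - 1)\<^sup>2) \<le> 21 / (1 + norm z ^ 2 / 4) / 4"
    by (simp only: divide_right_mono zero_le_numeral)
  also have "\<dots> = 21 / (4 + norm z ^ 2)"
    by (simp add: divide_simps)
  also have "\<dots> \<le> 21 / (1 + norm z ^ 2)"
    by (intro frac_le add_pos_nonneg) simp_all
  finally show ?thesis .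
qed

lemma bose_minus_inverse_lipschitz:
  fixes x y :: real
  assumes "0 < x" "\<bar>y\<bar> \<le> x"
  shows "norm ((bose (Complex x y) - 1 / Complex x y) - (bose (of_real x) - 1 / of_real x))
    \<le> 21 / (1 + x\<^sup>2) * \<bar>y\<bar>"
proof -
  let ?h = "\<lambda>z :: complex. bose z - 1 / z"
  define S where "S = closed_segment (of_real x) (Complex x y)"
  have S: "Re z = x \<and> \<bar>Im z\<bar> \<le> x" if "z \<in> S" for z
  proof -
    from that obtain u where u: "0 \<le> u" "u \<le> 1" "z = (1 - u) *\<^sub>R of_real x + u *\<^sub>R Complex x y"
      unfolding S_def closed_segment_def by blast
    have "Re z = x" "Im z = u * y" unfolding u(3) by (auto simp: algebra_simps)
    moreover have "\<bar>u * y\<bar> \<le> 1 * x" unfolding abs_mult using u assms by (intro mult_mono) auto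
    ultimately show ?thesis by simp
  qed
  have "norm (?h (Complex x y) - ?h (of_real x)) \<le> 21 / (1 + x\<^sup>2) * norm (Complex x y - of_real x)"
  proof (rule field_differentiable_bound[where S = S and f' = "\<lambda>z. 1 / z\<^sup>2 - exp z / (exp z - 1)\<^sup>2"])
    fix z assume z: "z \<in> S"
    have "norm (exp z) = exp x" using S[OF z] by simp
    then have "exp z \<noteq> 1" using assms by (metis exp_eq_one_iff less_irrefl norm_one)
    moreover have "z \<noteq> 0" using S[OF z] assms by auto
    ultimately show "(?h has_field_derivative (1 / z\<^sup>2 - exp z / (exp z - 1)\<^sup>2)) (at z within S)"
      unfolding bose_def by (auto intro!: derivative_eq_intros simp: power2_eq_square)
    have "norm (1 / z\<^sup>2 - exp z / (exp z - 1)\<^sup>2) \<le> 21 / (1 + norm z ^ 2)"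
      using S[OF z] assms by (intro bose_deriv_bound) auto
    also have "\<dots> \<le> 21 / (1 + x\<^sup>2)"
      using S[OF z] assms abs_Re_le_cmod[of z]
      by (intro frac_le add_pos_nonneg add_mono power_mono) simp_all
    finally show "norm (1 / z\<^sup>2 - exp z / (exp z - 1)\<^sup>2) \<le> 21 / (1 + x\<^sup>2)" .
  qed (auto simp: S_def)
  also have "Complex x y - of_real x = \<i> * of_real y" by (simp add: complex_eq_iff)
  finally show ?thesis by (simp add: norm_mult)
qed

lemma arctan_diff_ge:
  assumes "0 \<le> a" "a < b"
  shows "(b - a) / (1 + b\<^sup>2) \<le> arctan b - arctan a"
proof -
  obtain z where z: "z > a" "z < b" "arctan b - arctan a = (b - a) * inverse (1 + z\<^sup>2)"
    using MVT2[OF assms(2), of arctan "\<lambda>x. inverse (1 + x\<^sup>2)"] DERIV_arctan by blast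
  have "inverse (1 + b\<^sup>2) \<le> inverse (1 + z\<^sup>2)"
    using z assms by (intro le_imp_inverse_le add_mono power_mono add_pos_nonneg) simp_all
  then show ?thesis using z(3) assms by (simp add: divide_inverse mult_left_mono)
qed

text \<open>
  Multiplied by \<open>t\<close>, the sum is a lower Riemann sum of the integral of \<open>1 / (1 + x\<^sup>2)\<close> over the
  half-line, which is \<open>pi / 2\<close>.
\<close>

lemma cauchy_kernel_sum:
  assumes t: "t > (0 :: real)"
  shows "summable (\<lambda>m. 1 / (1 + (real (Suc m) * t)\<^sup>2))"
    and "(\<Sum>m. 1 / (1 + (real (Suc m) * t)\<^sup>2)) \<le> pi / (2 * t)"
proof -
  let ?f = "\<lambda>m. 1 / (1 + (real (Suc m) * t)\<^sup>2)"
  have bound: "(\<Sum>m<n. ?f m) \<le> pi / (2 * t)" for n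
  proof -
    have "?f m \<le> (arctan (real (Suc m) * t) - arctan (real m * t)) / t" for m
      using arctan_diff_ge[of "real m * t" "real (Suc m) * t"] t by (simp add: field_simps)
    then have "(\<Sum>m<n. ?f m) \<le> (\<Sum>m<n. (arctan (real (Suc m) * t) - arctan (real m * t)) / t)"
      by (intro sum_mono) auto
    also have "\<dots> = (\<Sum>m<n. arctan (real (Suc m) * t) - arctan (real m * t)) / t"
      by (simp add: sum_divide_distrib)
    also have "\<dots> = arctan (real n * t) / t"
      by (subst sum_lessThan_telescope) simp
    also have "\<dots> \<le> (pi / 2) / t"
      using t arctan_ubound[of "real n * t"] by (intro divide_right_mono) auto
    finally show ?thesis by simp
  qed
  show s: "summable ?f"
    by (rule bounded_imp_summable[where B = "pi / (2 * t)"])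
      (use bound in \<open>auto simp: lessThan_Suc_atMost [symmetric] simp del: sum.lessThan_Suc\<close>)
  show "suminf ?f \<le> pi / (2 * t)"
    using bound by (intro suminf_le_const s)
qed

lemma log_euler_summable:
  assumes "norm (z :: complex) < 1"
  shows "summable (\<lambda>m. z ^ Suc m / (1 - z ^ Suc m) / of_nat (Suc m))"
proof (rule summable_comparison_test')
  show "summable (\<lambda>m. norm z ^ m * (1 / (1 - norm z)))"
    using assms by (intro summable_mult2 summable_geometric) auto
  fix m :: nat
  have a: "norm z ^ Suc m \<le> norm z ^ m" "norm z ^ Suc m \<le> norm z ^ 1"
    using assms by (intro power_decreasing; simp)+
  have "1 - norm z \<le> norm (1 - z ^ Suc m)"
    using norm_triangle_ineq2[of 1 "z ^ Suc m"] a by (simp add: norm_power norm_mult)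
  then have "norm (z ^ Suc m / (1 - z ^ Suc m)) \<le> norm z ^ m / (1 - norm z)"
    unfolding norm_divide using assms a(1) by (intro frac_le) (auto simp: norm_mult norm_power)
  then have "norm (z ^ Suc m / (1 - z ^ Suc m)) / real (Suc m) \<le> norm z ^ m / (1 - norm z) / 1"
    using assms by (intro frac_le divide_nonneg_pos) (auto simp del: power_Suc)
  then show "norm (z ^ Suc m / (1 - z ^ Suc m) / of_nat (Suc m)) \<le> norm z ^ m * (1 / (1 - norm z))"
    by (simp add: norm_divide norm_mult del: power_Suc of_nat_Suc)
qed

lemma log_euler_sums:
  "norm z < 1 \<Longrightarrow> (\<lambda>m. z ^ Suc m / (1 - z ^ Suc m) / of_nat (Suc m)) sums log_euler z"
  unfolding log_euler_def by (intro summable_sums log_euler_summable)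

lemma log_euler_exp_sums:
  assumes "Re s > 0"
  shows "(\<lambda>m. bose (of_nat (Suc m) * s) / of_nat (Suc m)) sums log_euler (exp (- s))"
proof -
  have "exp (- s) ^ Suc m / (1 - exp (- s) ^ Suc m) = bose (of_nat (Suc m) * s)" for m
  proof -
    have "exp (- s) ^ Suc m = 1 / exp (of_nat (Suc m) * s)"
      by (subst exp_of_nat_mult [symmetric]) (simp add: exp_minus divide_inverse)
    moreover have "1 / E / (1 - 1 / E) = 1 / (E - 1)" if "E \<noteq> 0" for E :: complex
      using that by (simp add: divide_simps)
    ultimately show ?thesis by (simp only: bose_def exp_not_eq_zero not_False_eq_True)
  qed
  moreover have "norm (exp (- s)) < 1" using assms by simp
  ultimately show ?thesis using log_euler_sums[of "exp (- s)"] by (simp only:)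
qed

text \<open>
  Termwise, \<open>bose (m * s)\<close> is replaced by \<open>1 / (m * s)\<close>, which sums to \<open>pi\<^sup>2 / 6\<close> times \<open>1 / s\<close>. The
  Lipschitz bound for the difference contributes \<open>\<bar>\<theta>\<bar> / (1 + (m * t)\<^sup>2)\<close> to the \<open>m\<close>-th term.
\<close>

lemma log_euler_near_real:
  assumes "0 < t" "\<bar>\<theta>\<bar> \<le> t"
  defines "s \<equiv> Complex t \<theta>"
  shows "norm (log_euler (exp (- s)) - log_euler (exp (- of_real t))
      - of_real (pi\<^sup>2 / 6) * (1 / s - 1 / of_real t)) \<le> 21 * pi * \<bar>\<theta>\<bar> / (2 * t)"
proof -
  let ?h = "\<lambda>z :: complex. bose z - 1 / z"
  define d where "d m = (?h (of_nat (Suc m) * s) - ?h (of_nat (Suc m) * of_real t)) / of_nat (Suc m)" for m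
  have s0: "s \<noteq> 0" "Re s > 0" using assms by (auto simp: s_def complex_eq_iff)
  have basel: "(\<lambda>m. 1 / (of_nat (Suc m))\<^sup>2 * w) sums (of_real (pi\<^sup>2 / 6) * w)" for w :: complex
    using sums_of_real[OF inverse_squares_sums, where 'a = complex] by (intro sums_mult2) (simp add: add_ac)
  have "(\<lambda>m. bose (of_nat (Suc m) * s) / of_nat (Suc m) - bose (of_nat (Suc m) * of_real t) / of_nat (Suc m)
      - 1 / (of_nat (Suc m))\<^sup>2 * (1 / s - 1 / of_real t))
    sums (log_euler (exp (- s)) - log_euler (exp (- of_real t)) - of_real (pi\<^sup>2 / 6) * (1 / s - 1 / of_real t))"
    by (intro sums_diff log_euler_exp_sums basel) (use assms in \<open>auto simp: s_def\<close>)
  moreover have "bose (of_nat (Suc m) * s) / of_nat (Suc m) - bose (of_nat (Suc m) * of_real t) / of_nat (Suc m)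
      - 1 / (of_nat (Suc m))\<^sup>2 * (1 / s - 1 / of_real t) = d m" for m
    by (simp add: d_def diff_divide_distrib add_divide_distrib power2_eq_square algebra_simps del: of_nat_Suc)
  ultimately have sums: "d sums (log_euler (exp (- s)) - log_euler (exp (- of_real t))
      - of_real (pi\<^sup>2 / 6) * (1 / s - 1 / of_real t))" by simp
  have bound: "norm (d m) \<le> 21 * \<bar>\<theta>\<bar> * (1 / (1 + (real (Suc m) * t)\<^sup>2))" for m
  proof -
    define x where "x = real (Suc m) * t"
    define y where "y = real (Suc m) * \<theta>"
    have "norm (?h (Complex x y) - ?h (of_real x)) \<le> 21 / (1 + x\<^sup>2) * \<bar>y\<bar>"
      using assms by (intro bose_minus_inverse_lipschitz) (auto simp: x_def y_def abs_mult mult_left_mono)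
    moreover have "Complex x y = of_nat (Suc m) * s" "complex_of_real x = of_nat (Suc m) * of_real t"
      by (auto simp: x_def y_def s_def complex_eq_iff)
    ultimately have "norm (d m) \<le> 21 / (1 + x\<^sup>2) * \<bar>y\<bar> / real (Suc m)"
      unfolding d_def norm_divide norm_of_nat by (intro divide_right_mono) auto
    also have "\<dots> = 21 * \<bar>\<theta>\<bar> * (1 / (1 + x\<^sup>2))" by (simp add: y_def abs_mult del: of_nat_Suc)
    finally show ?thesis by (simp only: x_def)
  qed
  have "norm (suminf d) \<le> (\<Sum>m. 21 * \<bar>\<theta>\<bar> * (1 / (1 + (real (Suc m) * t)\<^sup>2)))"
    by (rule norm_suminf_le[OF bound]) (intro summable_mult cauchy_kernel_sum assms)
  also have "\<dots> = 21 * \<bar>\<theta>\<bar> * (\<Sum>m. 1 / (1 + (real (Suc m) * t)\<^sup>2))"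
    by (intro suminf_mult cauchy_kernel_sum assms)
  also have "\<dots> \<le> 21 * \<bar>\<theta>\<bar> * (pi / (2 * t))"
    by (intro mult_left_mono cauchy_kernel_sum assms) auto
  finally show ?thesis using sums_unique[OF sums] by (simp add: mult_ac)
qed

section \<open>The Euler product on the real axis\<close>

definition log_euler_real :: "real \<Rightarrow> real" where
  "log_euler_real t = Re (log_euler (exp (- of_real t)))"

lemma norm_exp_minus_less_1: "t > 0 \<Longrightarrow> norm (exp (- complex_of_real t)) < 1"
  by simp

lemma log_euler_real_sums_ln:
  assumes "t > 0"
  shows "(\<lambda>k. - ln (1 - exp (- (real (Suc k) * t)))) sums log_euler_real t"
proof -
  have "(\<lambda>k. Re (- Ln (1 - exp (- complex_of_real t) ^ Suc k))) sums Re (log_euler (exp (- of_real t)))"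
    by (intro sums_Re minus_Ln_sums_log_euler norm_exp_minus_less_1 assms)
  moreover have "Re (- Ln (1 - exp (- complex_of_real t) ^ Suc k)) = - ln (1 - exp (- (real (Suc k) * t)))" for k
  proof -
    have "1 - exp (- complex_of_real t) ^ Suc k = of_real (1 - exp (- (real (Suc k) * t)))"
      by (subst exp_of_nat_mult [symmetric]) (simp add: exp_of_real [symmetric] del: of_nat_Suc)
    moreover have "1 - exp (- (real (Suc k) * t)) > 0" using assms by simp
    ultimately show ?thesis using Ln_of_real by (metis Re_complex_of_real uminus_complex.sel(1))
  qed
  ultimately show ?thesis by (simp only: log_euler_real_def)
qed

lemma bose_of_real: "bose (of_real x :: complex) = of_real (bose x)"
  by (simp add: bose_def exp_of_real)

lemma log_euler_real_sums_bose:
  assumes "t > 0"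
  shows "(\<lambda>m. bose (real (Suc m) * t) / real (Suc m)) sums log_euler_real t"
proof -
  have "(\<lambda>m. Re (bose (of_nat (Suc m) * of_real t) / of_nat (Suc m))) sums Re (log_euler (exp (- of_real t)))"
    by (intro sums_Re log_euler_exp_sums) (use assms in auto)
  moreover have "bose (of_nat (Suc m) * of_real t :: complex) / of_nat (Suc m)
      = of_real (bose (real (Suc m) * t) / real (Suc m))" for m
    using bose_of_real[of "real (Suc m) * t"] by simp
  ultimately show ?thesis by (simp only: Re_complex_of_real log_euler_real_def)
qed

lemma log_euler_exp_of_real:
  assumes "t > 0"
  shows "log_euler (exp (- of_real t)) = of_real (log_euler_real t)"
proof -
  have "(\<lambda>m. bose (of_nat (Suc m) * of_real t :: complex) / of_nat (Suc m)) sums of_real (log_euler_real t)"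
    using sums_of_real[OF log_euler_real_sums_bose[OF assms], where 'a = complex] bose_of_real[of "real (Suc _) * t"]
    by simp
  then show ?thesis
    using sums_unique2[OF log_euler_exp_sums[of "of_real t"]] assms by simp
qed

lemma mult_bose_le_1: "x > 0 \<Longrightarrow> x * bose x \<le> (1 :: real)"
  using exp_ge_add_one_self[of x] by (simp add: bose_def field_simps)

text \<open>
  The crude asymptotics: \<open>t * bose (m * t) / m\<close> tends to \<open>1 / m\<^sup>2\<close> and is bounded by it.
\<close>

lemma mult_log_euler_real_tendsto: "((\<lambda>t. t * log_euler_real t) \<longlongrightarrow> pi\<^sup>2 / 6) (at_right 0)"
proof -
  have "((\<lambda>t. \<Sum>m. t * (bose (real (Suc m) * t) / real (Suc m))) \<longlongrightarrow> (\<Sum>m. 1 / (real m + 1)\<^sup>2)) (at_right 0)"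
  proof (rule tannerys_theorem[THEN conjunct2, THEN conjunct2])
    fix m
    have "((\<lambda>t. t * (1 / (exp (c * t) - 1) / c)) \<longlongrightarrow> 1 / c\<^sup>2) (at_right 0)" if "c > 0" for c :: real
      using that by real_asymp (simp add: power2_eq_square field_simps)
    from this[of "real (Suc m)"]
    show "((\<lambda>t. t * (bose (real (Suc m) * t) / real (Suc m))) \<longlongrightarrow> 1 / (real m + 1)\<^sup>2) (at_right 0)"
      by (simp add: bose_def add_ac)
  next
    have "norm (t * (bose (real (Suc m) * t) / real (Suc m))) \<le> 1 / (real m + 1)\<^sup>2" if "t > 0" for m t
    proof -
      have "t * (bose (real (Suc m) * t) / real (Suc m)) = (real (Suc m) * t) * bose (real (Suc m) * t) / (real m + 1)\<^sup>2"
        by (simp add: power2_eq_square add.commute[of 1])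
      also have "\<dots> \<le> 1 / (real m + 1)\<^sup>2"
        using that by (intro divide_right_mono mult_bose_le_1) auto
      finally show ?thesis using that by (simp add: bose_def)
    qed
    then show "\<forall>\<^sub>F (m, t) in sequentially \<times>\<^sub>F at_right 0.
        norm (t * (bose (real (Suc m) * t) / real (Suc m))) \<le> 1 / (real m + 1)\<^sup>2"
      unfolding eventually_prod_filter
      by (intro exI[of _ "\<lambda>_. True"] exI[of _ "\<lambda>t. 0 < t"]) (auto simp: eventually_at_right_less)
  qed (use inverse_squares_sums in \<open>auto simp: sums_iff add_ac\<close>)
  moreover have "(\<Sum>m. 1 / (real m + 1)\<^sup>2) = pi\<^sup>2 / 6"
    using inverse_squares_sums by (simp add: sums_iff add_ac)
  moreover have "\<forall>\<^sub>F t in at_right 0. (\<Sum>m. t * (bose (real (Suc m) * t) / real (Suc m))) = t * log_euler_real t"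
    using eventually_at_right_less[of "0 :: real"]
  proof eventually_elim
    case (elim t)
    show ?case using sums_mult[OF log_euler_real_sums_bose[OF elim], of t] by (simp only: sums_iff)
  qed
  ultimately show ?thesis by (simp only:) (rule Lim_transform_eventually)
qed

text \<open>
  This is the logarithm of the product formula for the sine at \<open>\<i> / t\<close>.
\<close>

lemma sinh_product_log:
  assumes t: "t > (0 :: real)"
  shows "(\<lambda>k. ln (1 + 1 / (real (Suc k) * t)\<^sup>2)) sums ln (sinh (pi / t) * t / pi)"
proof -
  define P where "P n = (\<Prod>k=1..n. 1 + 1 / (real k * t)\<^sup>2)" for n
  have pos: "1 + 1 / (real k * t)\<^sup>2 > 0" for k by (intro add_pos_nonneg) auto
  have "(\<lambda>n. of_real pi * (\<i> / of_real t) * (\<Prod>k=1..n. 1 - (\<i> / of_real t)\<^sup>2 / of_nat k^2))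
     \<longlonglongrightarrow> sin (of_real pi * (\<i> / of_real t))"
    by (rule sin_product_formula_complex)
  moreover have "(\<Prod>k=1..n. 1 - (\<i> / of_real t)\<^sup>2 / of_nat k^2) = complex_of_real (P n)" for n
    unfolding P_def of_real_prod by (intro prod.cong) (auto simp: power_divide power_mult_distrib)
  moreover have "sin (of_real pi * (\<i> / of_real t)) = \<i> * of_real (sinh (pi / t))"
    by (simp add: sinh_field_def sin_exp_eq exp_of_real [symmetric] exp_minus field_simps)
  ultimately have "(\<lambda>n. Im (of_real pi * (\<i> / of_real t) * complex_of_real (P n))) \<longlonglongrightarrow> Im (\<i> * of_real (sinh (pi / t)))"
    by (intro tendsto_Im) simp
  then have "(\<lambda>n. pi / t * P n * (t / pi)) \<longlonglongrightarrow> sinh (pi / t) * (t / pi)"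
    by (intro tendsto_mult) (auto simp: Im_divide_of_real)
  then have "P \<longlonglongrightarrow> sinh (pi / t) * t / pi" using t by simp
  then have "(\<lambda>n. ln (P n)) \<longlonglongrightarrow> ln (sinh (pi / t) * t / pi)"
    using t by (intro tendsto_ln) auto
  moreover have "ln (P n) = (\<Sum>k<n. ln (1 + 1 / (real (Suc k) * t)\<^sup>2))" for n
  proof -
    have "ln (P n) = (\<Sum>k=1..n. ln (1 + 1 / (real k * t)\<^sup>2))"
      unfolding P_def by (rule ln_prod) (use pos in \<open>auto simp: less_imp_neq[THEN not_sym]\<close>)
    also have "\<dots> = (\<Sum>k<n. ln (1 + 1 / (real (Suc k) * t)\<^sup>2))"
      by (rule sum.reindex_bij_witness[of _ Suc "\<lambda>k. k - 1"]) auto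
    finally show ?thesis .
  qed
  ultimately show ?thesis by (simp add: sums_def)
qed

text \<open>
  Subtracting \<open>ln (1 + 1 / x\<^sup>2) / 2\<close> removes the singularity \<open>- ln x\<close> at 0 and leaves a function with
  limit 0 there. With the conventions \<open>ln 0 = 0\<close> and \<open>1 / 0 = 0\<close> the formula itself gives the
  value 0 at 0.
\<close>

definition log_remainder :: "real \<Rightarrow> real" where
  "log_remainder x = - ln (1 - exp (- x)) - ln (1 + 1 / x\<^sup>2) / 2"

lemma log_remainder_0 [simp]: "log_remainder 0 = 0"
  by (simp add: log_remainder_def)

lemma one_plus_inverse_square_pos: "0 < 1 + 1 / (x :: real)\<^sup>2"
  by (intro add_pos_nonneg) auto

lemma continuous_on_log_remainder: "continuous_on {0..} log_remainder"
proof -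
  have "(log_remainder \<longlongrightarrow> log_remainder x) (at x within {0..})" if "x \<ge> 0" for x
  proof (cases "x = 0")
    case True
    have "((\<lambda>x :: real. - ln (1 - exp (- x)) - ln (1 + 1 / x\<^sup>2) / 2) \<longlongrightarrow> 0) (at_right 0)"
      by real_asymp
    then show ?thesis unfolding True log_remainder_0 log_remainder_def
      by (simp add: at_within_Ici_at_right)
  next
    case False
    with that have "x > 0" by simp
    then have "isCont log_remainder x"
      unfolding log_remainder_def using one_plus_inverse_square_pos[of x]
      by (intro continuous_intros) auto
    then show ?thesis by (auto simp: continuous_within intro: tendsto_within_subset)
  qed
  then show ?thesis by (simp add: continuous_on_def)
qed

lemma log_remainder_deriv:
  assumes "x > 0"
  shows "(log_remainder has_real_derivative (1 / x - x / (1 + x\<^sup>2) - 1 / (exp x - 1))) (at x)"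
proof -
  have pos: "1 - exp (- x) > 0" "1 + x\<^sup>2 > 0" using assms by (auto intro: add_pos_nonneg)
  have "exp (- x) / (1 - exp (- x)) = 1 / (exp x - 1)"
    using assms by (simp add: exp_minus field_simps)
  then have "((\<lambda>x. - ln (1 - exp (- x)) + ln x - ln (1 + x\<^sup>2) / 2) has_real_derivative
      (1 / x - x / (1 + x\<^sup>2) - 1 / (exp x - 1))) (at x)"
    using pos assms by (auto intro!: derivative_eq_intros) (simp add: divide_simps)
  then show ?thesis
  proof (rule has_field_derivative_transform_within_open)
    fix y :: real assume y: "y \<in> {0<..}"
    have "1 + 1 / y\<^sup>2 = (1 + y\<^sup>2) / y\<^sup>2" using y by (simp add: field_simps)
    then have "ln (1 + 1 / y\<^sup>2) = ln (1 + y\<^sup>2) - 2 * ln y"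
      using y by (simp add: ln_div ln_realpow less_imp_neq[OF add_pos_nonneg, THEN not_sym])
    then show "- ln (1 - exp (- y)) + ln y - ln (1 + y\<^sup>2) / 2 = log_remainder y"
      by (simp add: log_remainder_def field_simps)
  qed (use assms in auto)
qed

lemma log_remainder_deriv2:
  assumes "x > 0"
  shows "((\<lambda>x. 1 / x - x / (1 + x\<^sup>2) - 1 / (exp x - 1)) has_real_derivative
    (exp x / (exp x - 1)\<^sup>2 - 1 / x\<^sup>2 - (1 - x\<^sup>2) / (1 + x\<^sup>2)\<^sup>2)) (at x)"
proof -
  have "1 + x\<^sup>2 \<noteq> 0" using zero_le_power2[of x] by linarith
  then show ?thesis using assms
    by (auto intro!: derivative_eq_intros simp: power2_eq_square algebra_simps)
qed

lemma log_remainder_deriv2_bound: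
  assumes "x > (0 :: real)"
  shows "\<bar>exp x / (exp x - 1)\<^sup>2 - 1 / x\<^sup>2 - (1 - x\<^sup>2) / (1 + x\<^sup>2)\<^sup>2\<bar> \<le> 22 / (1 + x\<^sup>2)"
proof -
  have "norm (1 / (of_real x)\<^sup>2 - exp (of_real x) / (exp (of_real x) - 1)\<^sup>2 :: complex) \<le> 21 / (1 + norm (complex_of_real x) ^ 2)"
    by (rule bose_deriv_bound) (use assms in auto)
  also have "1 / (of_real x)\<^sup>2 - exp (of_real x) / (exp (of_real x) - 1)\<^sup>2 = complex_of_real (1 / x\<^sup>2 - exp x / (exp x - 1)\<^sup>2)"
    by (simp add: exp_of_real)
  finally have 1: "\<bar>1 / x\<^sup>2 - exp x / (exp x - 1)\<^sup>2\<bar> \<le> 21 / (1 + x\<^sup>2)"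
    by (simp only: norm_of_real power2_abs)
  have "\<bar>(1 - x\<^sup>2) / (1 + x\<^sup>2)\<^sup>2\<bar> = \<bar>1 - x\<^sup>2\<bar> / (1 + x\<^sup>2)\<^sup>2" by simp
  also have "\<dots> \<le> (1 + x\<^sup>2) / (1 + x\<^sup>2)\<^sup>2"
    by (intro divide_right_mono) (auto simp: abs_le_iff)
  also have "\<dots> = 1 / (1 + x\<^sup>2)" by (simp add: power2_eq_square)
  finally have 2: "\<bar>(1 - x\<^sup>2) / (1 + x\<^sup>2)\<^sup>2\<bar> \<le> 1 / (1 + x\<^sup>2)" .
  have "22 / (1 + x\<^sup>2) = 21 / (1 + x\<^sup>2) + 1 / (1 + x\<^sup>2)" by (simp add: add_divide_distrib [symmetric])
  then show ?thesis using 1 2 by linarith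
qed

text \<open>
  The local error of the trapezoidal rule when a step is halved. The derivatives are computed on
  the open half-line only, hence the mean value theorem is used with continuity alone at the left
  endpoint.
\<close>

lemma log_remainder_second_difference:
  assumes "0 \<le> a" "0 < t"
  shows "\<bar>log_remainder a + log_remainder (a + t) - 2 * log_remainder (a + t / 2)\<bar> \<le> 11 * t\<^sup>2 / (1 + a\<^sup>2)"
proof -
  define g' where "g' = (\<lambda>x :: real. 1 / x - x / (1 + x\<^sup>2) - 1 / (exp x - 1))"
  define g'' where "g'' = (\<lambda>x :: real. exp x / (exp x - 1)\<^sup>2 - 1 / x\<^sup>2 - (1 - x\<^sup>2) / (1 + x\<^sup>2)\<^sup>2)"
  have mvt: "\<exists>z. u < z \<and> z < v \<and> log_remainder v - log_remainder u = (v - u) * g' z" if "a \<le> u" "u < v" for u v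
  proof -
    have D: "(log_remainder has_real_derivative g' x) (at x)" if "u < x" for x
      unfolding g'_def by (rule log_remainder_deriv) (use that \<open>a \<le> u\<close> assms in auto)
    obtain l z where z: "u < z" "z < v" "(log_remainder has_real_derivative l) (at z)"
        "log_remainder v - log_remainder u = (v - u) * l"
    proof (rule MVT[OF \<open>u < v\<close>, of log_remainder, THEN exE])
      show "continuous_on {u..v} log_remainder"
        by (rule continuous_on_subset[OF continuous_on_log_remainder]) (use \<open>a \<le> u\<close> assms in auto)
    qed (use D real_differentiable_def in blast)+
    then show ?thesis using DERIV_unique[OF D[of z]] by blast
  qed
  obtain y where y: "a < y" "y < a + t / 2" "log_remainder (a + t / 2) - log_remainder a = (t / 2) * g' y"
    using mvt[of a "a + t / 2"] assms by auto
  obtain z where z: "a + t / 2 < z" "z < a + t" "log_remainder (a + t) - log_remainder (a + t / 2) = (t / 2) * g' z"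
    using mvt[of "a + t / 2" "a + t"] assms by (auto simp: field_simps)
  have "y < z" using y z by simp
  then obtain w where w: "y < w" "w < z" "g' z - g' y = (z - y) * g'' w"
    using MVT2[of y z g' g''] log_remainder_deriv2 y assms unfolding g'_def g''_def by fastforce
  have "\<bar>g'' w\<bar> \<le> 22 / (1 + w\<^sup>2)"
    unfolding g''_def by (rule log_remainder_deriv2_bound) (use w y assms in auto)
  also have "\<dots> \<le> 22 / (1 + a\<^sup>2)"
    using w y assms by (intro frac_le add_pos_nonneg add_mono power_mono) auto
  finally have "\<bar>(t / 2) * ((z - y) * g'' w)\<bar> \<le> (t / 2) * (t * (22 / (1 + a\<^sup>2)))"
    unfolding abs_mult using w y z assms by (intro mult_mono) auto
  also have "(t / 2) * ((z - y) * g'' w) = log_remainder a + log_remainder (a + t) - 2 * log_remainder (a + t / 2)"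
  proof -
    have "(t / 2) * ((z - y) * g'' w) = (t / 2) * g' z - (t / 2) * g' y"
      by (simp only: w(3) [symmetric] right_diff_distrib)
    then show ?thesis using y(3) z(3) by linarith
  qed
  finally show ?thesis by (simp add: power2_eq_square)
qed

text \<open>
  The sum of \<open>log_remainder\<close> over the positive multiples of \<open>t\<close>, in closed form.
\<close>

definition remainder_sum :: "real \<Rightarrow> real" where
  "remainder_sum t = log_euler_real t - ln (sinh (pi / t) * t / pi) / 2"

lemma remainder_sum_sums:
  assumes "t > 0"
  shows "(\<lambda>k. log_remainder (real (Suc k) * t)) sums remainder_sum t"
  unfolding log_remainder_def remainder_sum_def
  by (intro sums_diff sums_divide log_euler_real_sums_ln sinh_product_log assms)

text \<open>
  Both \<open>t * remainder_sum t\<close> and \<open>(t / 2) * remainder_sum (t / 2)\<close> are trapezoidal sums of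
  \<open>log_remainder\<close> over the half-line, with steps \<open>t\<close> and \<open>t / 2\<close>. Up to the factor \<open>t / 4\<close> their
  difference is the sum of the second differences over the cells of length \<open>t\<close>.
\<close>

lemma remainder_sum_halving:
  assumes t: "0 < t" "t \<le> 1"
  shows "\<bar>2 * remainder_sum t - remainder_sum (t / 2)\<bar> \<le> 18 * t"
proof -
  let ?g = log_remainder
  have s: "(\<lambda>k. ?g (real (Suc k) * t)) sums remainder_sum t"
    using t by (intro remainder_sum_sums)
  then have s0: "(\<lambda>k. ?g (real k * t)) sums remainder_sum t"
    by (subst (asm) sums_Suc_iff) simp
  have "(\<lambda>k. sum (\<lambda>j. ?g (real (Suc j) * (t / 2))) {k * 2..<k * 2 + 2}) sums remainder_sum (t / 2)"
    using t by (intro sums_group remainder_sum_sums) auto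
  moreover have "sum (\<lambda>j. ?g (real (Suc j) * (t / 2))) {k * 2..<k * 2 + 2}
      = ?g (real k * t + t / 2) + ?g (real (Suc k) * t)" for k
  proof -
    have pair: "sum h {k * 2..<k * 2 + 2} = h (2 * k) + h (Suc (2 * k))" for h :: "nat \<Rightarrow> real"
      by (simp add: mult.commute)
    have half: "real (Suc (2 * k)) * (t / 2) = real k * t + t / 2"
      "real (Suc (Suc (2 * k))) * (t / 2) = real (Suc k) * t"
      by (simp_all add: field_simps)
    show ?thesis unfolding pair half ..
  qed
  ultimately have "(\<lambda>k. ?g (real k * t + t / 2) + ?g (real (Suc k) * t) - ?g (real (Suc k) * t))
      sums (remainder_sum (t / 2) - remainder_sum t)"
    by (intro sums_diff s) simp
  then have mid: "(\<lambda>k. ?g (real k * t + t / 2)) sums (remainder_sum (t / 2) - remainder_sum t)"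
    by simp
  define d where "d k = ?g (real k * t) + ?g (real (Suc k) * t) - 2 * ?g (real k * t + t / 2)" for k
  have "d sums (remainder_sum t + remainder_sum t - 2 * (remainder_sum (t / 2) - remainder_sum t))"
    unfolding d_def by (intro sums_diff sums_add sums_mult s s0 mid)
  then have ds: "d sums (2 * (2 * remainder_sum t - remainder_sum (t / 2)))" by (simp add: algebra_simps)
  have bound: "norm (d k) \<le> 11 * t\<^sup>2 * (1 / (1 + (real k * t)\<^sup>2))" for k
    using log_remainder_second_difference[of "real k * t" t] t by (simp add: d_def algebra_simps)
  have c: "(\<lambda>k. 1 / (1 + (real (Suc k) * t)\<^sup>2)) sums (\<Sum>k. 1 / (1 + (real (Suc k) * t)\<^sup>2))"
    using t by (intro summable_sums cauchy_kernel_sum)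
  then have c0: "(\<lambda>k. 1 / (1 + (real k * t)\<^sup>2)) sums ((\<Sum>k. 1 / (1 + (real (Suc k) * t)\<^sup>2)) + 1)"
    by (subst (asm) sums_Suc_iff) simp
  have "norm (suminf d) \<le> (\<Sum>k. 11 * t\<^sup>2 * (1 / (1 + (real k * t)\<^sup>2)))"
    by (rule norm_suminf_le[OF bound]) (intro summable_mult sums_summable[OF c0])
  also have "\<dots> = 11 * t\<^sup>2 * ((\<Sum>k. 1 / (1 + (real (Suc k) * t)\<^sup>2)) + 1)"
    using sums_mult[OF c0] by (rule sums_unique[symmetric])
  also have "\<dots> \<le> 11 * t\<^sup>2 * (pi / (2 * t) + 1)"
    using t by (intro mult_left_mono add_mono cauchy_kernel_sum) auto
  also have "\<dots> = 11 * t * (pi / 2 + t)" using t by (simp add: field_simps power2_eq_square)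
  also have "\<dots> \<le> 11 * t * 3"
    using t pi_less_4 by (intro mult_left_mono) auto
  finally have "\<bar>2 * (2 * remainder_sum t - remainder_sum (t / 2))\<bar> \<le> 33 * t"
    using sums_unique[OF ds] by simp
  then show ?thesis using t by (simp add: abs_mult)
qed

lemma mult_remainder_sum_tendsto:
  "((\<lambda>t. t * remainder_sum t) \<longlongrightarrow> pi\<^sup>2 / 6 - pi / 2) (at_right 0)"
proof -
  have "((\<lambda>t :: real. t * (ln (((exp (pi / t) - exp (- (pi / t))) / 2) * t / pi) / 2)) \<longlongrightarrow> pi / 2) (at_right 0)"
    using pi_gt_zero by real_asymp
  then have "((\<lambda>t :: real. t * (ln (sinh (pi / t) * t / pi) / 2)) \<longlongrightarrow> pi / 2) (at_right 0)"
    by (simp only: sinh_field_def)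
  from tendsto_diff[OF mult_log_euler_real_tendsto this] show ?thesis
    by (simp add: remainder_sum_def right_diff_distrib)
qed

text \<open>
  Halving the step repeatedly changes \<open>t * remainder_sum t\<close> by a geometric series of total size
  \<open>O (t\<^sup>2)\<close>. The limit is known from the crude asymptotics, so the integral of \<open>log_remainder\<close> never
  has to be computed.
\<close>

lemma remainder_sum_estimate:
  assumes t: "0 < t" "t \<le> 1"
  shows "\<bar>remainder_sum t - (pi\<^sup>2 / 6 - pi / 2) / t\<bar> \<le> 18 * t"
proof -
  define U where "U n = t / 2 ^ n * remainder_sum (t / 2 ^ n)" for n
  have step: "\<bar>U n - U (Suc n)\<bar> \<le> 9 * t\<^sup>2 / 4 ^ n" for n
  proof -
    define s where "s = t / 2 ^ n"
    have "t / 2 ^ n \<le> 1 / 1" using t by (intro frac_le) auto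
    then have s: "0 < s" "s \<le> 1" using t by (auto simp: s_def)
    have "t / 2 ^ Suc n = s / 2" by (simp add: s_def)
    then have "U n - U (Suc n) = s * remainder_sum s - s / 2 * remainder_sum (s / 2)"
      by (simp only: U_def s_def)
    also have "\<dots> = s / 2 * (2 * remainder_sum s - remainder_sum (s / 2))"
      by (simp add: right_diff_distrib)
    finally have "U n - U (Suc n) = s / 2 * (2 * remainder_sum s - remainder_sum (s / 2))" .
    then have "\<bar>U n - U (Suc n)\<bar> = s / 2 * \<bar>2 * remainder_sum s - remainder_sum (s / 2)\<bar>"
      using s by (simp only: abs_mult)
    also have "\<dots> \<le> s / 2 * (18 * s)"
      using s by (intro mult_left_mono remainder_sum_halving) auto
    also have "\<dots> = 9 * t\<^sup>2 / 4 ^ n"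
      by (simp add: s_def power2_eq_square power_mult_distrib [symmetric])
    finally show ?thesis .
  qed
  have telescoped: "\<bar>U 0 - U n\<bar> \<le> 18 * t\<^sup>2 * (1 - 1 / 2 ^ n)" for n
  proof (induction n)
    case (Suc n)
    have "9 * t\<^sup>2 / 4 ^ n \<le> 9 * t\<^sup>2 / 2 ^ n" by (intro divide_left_mono power_mono) auto
    then have "\<bar>U 0 - U (Suc n)\<bar> \<le> 18 * t\<^sup>2 * (1 - 1 / 2 ^ n) + 9 * t\<^sup>2 / 2 ^ n"
      using Suc step[of n] by linarith
    then show ?case by (simp add: field_simps)
  qed simp
  have bound: "\<bar>U 0 - U n\<bar> \<le> 18 * t\<^sup>2" for n
  proof -
    have "18 * t\<^sup>2 * (1 - 1 / 2 ^ n) \<le> 18 * t\<^sup>2 * 1" by (intro mult_left_mono) auto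
    with telescoped[of n] show ?thesis by linarith
  qed
  have "filterlim (\<lambda>n. t / 2 ^ n) (at_right 0) sequentially"
    by (rule tendsto_imp_filterlim_at_right) (use t in \<open>auto intro: LIMSEQ_divide_realpow_zero\<close>)
  then have "U \<longlonglongrightarrow> pi\<^sup>2 / 6 - pi / 2"
    unfolding U_def by (rule filterlim_compose[OF mult_remainder_sum_tendsto])
  then have "(\<lambda>n. \<bar>U 0 - U n\<bar>) \<longlonglongrightarrow> \<bar>U 0 - (pi\<^sup>2 / 6 - pi / 2)\<bar>"
    by (intro tendsto_intros)
  then have "\<bar>U 0 - (pi\<^sup>2 / 6 - pi / 2)\<bar> \<le> 18 * t\<^sup>2"
    by (rule LIMSEQ_le_const2) (use bound in auto)
  moreover have "U 0 - (pi\<^sup>2 / 6 - pi / 2) = t * (remainder_sum t - (pi\<^sup>2 / 6 - pi / 2) / t)"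
    using t by (simp add: U_def field_simps)
  ultimately have "t * \<bar>remainder_sum t - (pi\<^sup>2 / 6 - pi / 2) / t\<bar> \<le> t * (18 * t)"
    using t by (simp add: abs_mult power2_eq_square mult_ac)
  then show ?thesis using t by (simp only: mult_le_cancel_left_pos)
qed

lemma log_euler_real_asymptotics:
  "((\<lambda>t. log_euler_real t - pi\<^sup>2 / (6 * t) - ln t / 2) \<longlongrightarrow> - ln (2 * pi) / 2) (at_right 0)"
proof -
  have "((\<lambda>t. remainder_sum t - (pi\<^sup>2 / 6 - pi / 2) / t) \<longlongrightarrow> 0) (at_right 0)"
  proof (rule Lim_null_comparison)
    show "\<forall>\<^sub>F t in at_right 0. norm (remainder_sum t - (pi\<^sup>2 / 6 - pi / 2) / t) \<le> 18 * t"
      unfolding eventually_at_right_field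
      using remainder_sum_estimate by (intro exI[of _ 1]) auto
    show "((\<lambda>t :: real. 18 * t) \<longlongrightarrow> 0) (at_right 0)" by real_asymp
  qed
  moreover have "((\<lambda>t :: real. ln (((exp (pi / t) - exp (- (pi / t))) / 2) * t / pi) / 2 - pi / 2 / t - ln t / 2)
      \<longlongrightarrow> - ln (2 * pi) / 2) (at_right 0)"
    using pi_gt_zero by real_asymp (simp add: ln_mult ln_inverse ln_div)
  ultimately have "((\<lambda>t. (remainder_sum t - (pi\<^sup>2 / 6 - pi / 2) / t) +
      (ln (((exp (pi / t) - exp (- (pi / t))) / 2) * t / pi) / 2 - pi / 2 / t - ln t / 2))
      \<longlongrightarrow> 0 + - ln (2 * pi) / 2) (at_right 0)"
    by (rule tendsto_add)
  moreover have "(remainder_sum t - (pi\<^sup>2 / 6 - pi / 2) / t) +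
      (ln (((exp (pi / t) - exp (- (pi / t))) / 2) * t / pi) / 2 - pi / 2 / t - ln t / 2)
      = log_euler_real t - pi\<^sup>2 / (6 * t) - ln t / 2" for t
    by (simp add: remainder_sum_def sinh_field_def diff_divide_distrib)
  ultimately show ?thesis by (simp only: add_0_left)
qed

section \<open>The integrand of Cauchy's formula\<close>

lemma cubic_gf_exp:
  "cubic_gf (exp (- s)) = exp (log_euler (exp (- s)) + log_euler (exp (- (2 * s))))"
proof -
  have "exp (- s) ^ 2 = exp (- (2 * s))"
    using exp_double[of "- s"] by simp
  then show ?thesis by (simp only: cubic_gf_def)
qed

lemma cubic_gf_exp_of_real:
  assumes "t > 0"
  shows "cubic_gf (exp (- of_real t)) = of_real (exp (log_euler_real t + log_euler_real (2 * t)))"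
  using log_euler_exp_of_real[of t] log_euler_exp_of_real[of "2 * t"] assms
  by (simp add: cubic_gf_exp exp_of_real [symmetric])

lemma Complex_minus_eq: "Complex (- t) \<theta> = - Complex t (- \<theta>)"
  by (simp add: complex_eq_iff)

text \<open>
  The terms for \<open>z\<close> and \<open>z\<^sup>2\<close> contribute \<open>pi\<^sup>2 / 6\<close> and \<open>pi\<^sup>2 / 12\<close>, together \<open>pi\<^sup>2 / 4\<close>.
\<close>

lemma log_cubic_gf_near_real:
  assumes t: "0 < t" and \<theta>: "\<bar>\<theta>\<bar> \<le> t"
  defines "s \<equiv> Complex t (- \<theta>)"
  shows "norm ((log_euler (exp (- s)) + log_euler (exp (- (2 * s)))) - of_real (log_euler_real t + log_euler_real (2 * t))
     - of_real (pi\<^sup>2 / 4) * (1 / s - 1 / of_real t)) \<le> 21 * pi * \<bar>\<theta>\<bar> / t"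
proof -
  define d where "d s t = log_euler (exp (- s)) - of_real (log_euler_real t)
     - of_real (pi\<^sup>2 / 6) * (1 / s - 1 / complex_of_real t)" for s t
  have 1: "norm (d s t) \<le> 21 * pi * \<bar>\<theta>\<bar> / (2 * t)"
    using log_euler_near_real[of t "- \<theta>"] assms by (simp add: d_def log_euler_exp_of_real)
  have "2 * s = Complex (2 * t) (- (2 * \<theta>))" by (simp add: s_def complex_eq_iff)
  then have 2: "norm (d (2 * s) (2 * t)) \<le> 21 * pi * \<bar>\<theta>\<bar> / (2 * t)"
    using log_euler_near_real[of "2 * t" "- (2 * \<theta>)"] log_euler_exp_of_real[of "2 * t"] assms by (simp add: d_def abs_mult)
  have "(log_euler (exp (- s)) + log_euler (exp (- (2 * s)))) - of_real (log_euler_real t + log_euler_real (2 * t))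
     - of_real (pi\<^sup>2 / 4) * (1 / s - 1 / of_real t) = d s t + d (2 * s) (2 * t)"
    by (simp add: d_def algebra_simps)
  then have "norm ((log_euler (exp (- s)) + log_euler (exp (- (2 * s)))) - of_real (log_euler_real t + log_euler_real (2 * t))
     - of_real (pi\<^sup>2 / 4) * (1 / s - 1 / of_real t)) \<le> 21 * pi * \<bar>\<theta>\<bar> / (2 * t) + 21 * pi * \<bar>\<theta>\<bar> / (2 * t)"
    using norm_triangle_mono[OF 1 2] by (simp only:)
  then show ?thesis by (simp add: field_simps)
qed

text \<open>
  The integrand of Cauchy's formula on the circle of radius \<open>exp (- t)\<close>, normalised at \<open>\<theta> = 0\<close> and
  rescaled to the width \<open>t powr (3 / 2)\<close> of the peak. The frequency \<open>pi\<^sup>2 / (4 * t\<^sup>2)\<close> is the index \<open>n\<close>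
  whose saddle point is \<open>t\<close>.
\<close>

definition scaled_integrand :: "real \<Rightarrow> real \<Rightarrow> complex" where
  "scaled_integrand t u = (let \<theta> = t * sqrt t * u in indicator {-pi..pi} \<theta> *\<^sub>R
     (cubic_gf (exp (Complex (- t) \<theta>)) / cubic_gf (exp (- of_real t)) * cis (- (pi\<^sup>2 / (4 * t\<^sup>2) * \<theta>))))"

text \<open>
  For \<open>s = t - \<i> * \<theta>\<close> the linear terms in \<open>\<theta>\<close> of \<open>pi\<^sup>2 / 4 * (1 / s - 1 / t)\<close> and of the phase cancel,
  because \<open>t\<close> is the saddle point. What remains is \<open>- (pi\<^sup>2 / 4) * u\<^sup>2 * (t / s)\<close>, and \<open>t / s\<close> tends
  to 1.
\<close>

lemma scaled_integrand_tendsto: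
  "((\<lambda>t. scaled_integrand t u) \<longlongrightarrow> of_real (exp (- (pi\<^sup>2 * u\<^sup>2 / 4)))) (at_right 0)"
proof -
  define \<theta> where "\<theta> t = t * sqrt t * u" for t
  define s where "s t = Complex t (- \<theta> t)" for t
  define err where "err t = (log_euler (exp (- s t)) + log_euler (exp (- (2 * s t)))) - of_real (log_euler_real t + log_euler_real (2 * t))
     - of_real (pi\<^sup>2 / 4) * (1 / s t - 1 / of_real t)" for t
  have small: "\<forall>\<^sub>F t in at_right 0. \<bar>\<theta> t\<bar> \<le> t"
  proof -
    have "((\<lambda>t. sqrt t * \<bar>u\<bar>) \<longlongrightarrow> sqrt 0 * \<bar>u\<bar>) (at_right 0)" by (intro tendsto_intros)
    then have "\<forall>\<^sub>F t in at_right 0. sqrt t * \<bar>u\<bar> < 1"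
      by (rule order_tendstoD) simp
    then show ?thesis using eventually_at_right_less[of "0 :: real"]
    proof eventually_elim
      case (elim t)
      then have "t * (sqrt t * \<bar>u\<bar>) \<le> t * 1" by (intro mult_left_mono) auto
      then show ?case using elim by (simp add: \<theta>_def abs_mult)
    qed
  qed
  have "(err \<longlongrightarrow> 0) (at_right 0)"
  proof (rule Lim_null_comparison)
    show "\<forall>\<^sub>F t in at_right 0. norm (err t) \<le> 21 * pi * (sqrt t * \<bar>u\<bar>)"
      using small eventually_at_right_less[of "0 :: real"]
    proof eventually_elim
      case (elim t)
      have "norm (err t) \<le> 21 * pi * \<bar>\<theta> t\<bar> / t"
        unfolding err_def s_def by (rule log_cubic_gf_near_real) (use elim in auto)
      also have "\<dots> = 21 * pi * (sqrt t * \<bar>u\<bar>)" using elim by (simp add: \<theta>_def abs_mult)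
      finally show ?case .
    qed
    have "((\<lambda>t. 21 * pi * (sqrt t * \<bar>u\<bar>)) \<longlongrightarrow> 21 * pi * (sqrt 0 * \<bar>u\<bar>)) (at_right 0)"
      by (intro tendsto_intros)
    then show "((\<lambda>t. 21 * pi * (sqrt t * \<bar>u\<bar>)) \<longlongrightarrow> 0) (at_right 0)" by simp
  qed
  moreover have "((\<lambda>t. - of_real (pi\<^sup>2 * u\<^sup>2 / 4) * (1 / Complex 1 (- (sqrt t * u)))) \<longlongrightarrow>
      - of_real (pi\<^sup>2 * u\<^sup>2 / 4) * (1 / Complex 1 (- (sqrt 0 * u)))) (at_right 0)"
    by (intro tendsto_intros) (auto simp: complex_eq_iff)
  ultimately have "((\<lambda>t. exp (err t + - of_real (pi\<^sup>2 * u\<^sup>2 / 4) * (1 / Complex 1 (- (sqrt t * u))))) \<longlongrightarrow>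
      exp (0 + - of_real (pi\<^sup>2 * u\<^sup>2 / 4) * (1 / Complex 1 (- (sqrt 0 * u))))) (at_right 0)"
    by (intro tendsto_exp tendsto_add)
  moreover have "exp (0 + - of_real (pi\<^sup>2 * u\<^sup>2 / 4) * (1 / Complex 1 (- (sqrt 0 * u)))) = complex_of_real (exp (- (pi\<^sup>2 * u\<^sup>2 / 4)))"
  proof -
    have "Complex 1 (- (sqrt 0 * u)) = 1" by (simp add: complex_eq_iff)
    then show ?thesis by (simp add: exp_of_real [symmetric])
  qed
  moreover have "\<forall>\<^sub>F t in at_right 0. exp (err t + - of_real (pi\<^sup>2 * u\<^sup>2 / 4) * (1 / Complex 1 (- (sqrt t * u)))) = scaled_integrand t u"
    using small eventually_at_right_less[of "0 :: real"] eventually_at_right_real[of 0 1, simplified]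
  proof eventually_elim
    case (elim t)
    then have t: "0 < t" "t < 1" by auto
    define w where "w = Complex 1 (- (sqrt t * u))"
    have w: "w \<noteq> 0" "s t = of_real t * w"
      by (auto simp: w_def s_def \<theta>_def complex_eq_iff)
    have ind: "indicator {-pi..pi} (\<theta> t) = (1 :: real)"
      using elim pi_gt3 t by (auto simp: indicator_def abs_le_iff)
    have sqt: "complex_of_real (sqrt t) * of_real (sqrt t) = of_real t"
      using t by (simp flip: of_real_mult)
    have w2: "w = 1 - \<i> * of_real (sqrt t) * of_real u" by (simp add: w_def complex_eq_iff)
    \<comment> \<open>Writing \<open>s = t * w\<close>, the two first-order terms combine to a multiple of \<open>(1 - w)\<^sup>2\<close>.\<close>
    have phase: "of_real (pi\<^sup>2 / 4) * (1 / s t - 1 / of_real t) + \<i> * of_real (- (pi\<^sup>2 / (4 * t\<^sup>2) * \<theta> t))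
       = - of_real (pi\<^sup>2 * u\<^sup>2 / 4) * (1 / w)"
    proof -
      have "1 / s t - 1 / of_real t = (1 - w) / (of_real t * w)"
        using t w by (simp add: field_simps)
      moreover have "\<i> * of_real (- (pi\<^sup>2 / (4 * t\<^sup>2) * \<theta> t)) = - of_real (pi\<^sup>2 / 4) * (1 - w) / of_real t"
        using t by (simp add: w2 \<theta>_def power2_eq_square)
      moreover have "p * ((1 - w) / (x * w)) + - p * (1 - w) / x = p * ((1 - w) * (1 - w) / (x * w))"
        if "x \<noteq> 0" for p x :: complex
        using that w(1) by (simp add: field_simps)
      ultimately have "of_real (pi\<^sup>2 / 4) * (1 / s t - 1 / of_real t) + \<i> * of_real (- (pi\<^sup>2 / (4 * t\<^sup>2) * \<theta> t))
         = of_real (pi\<^sup>2 / 4) * ((1 - w) * (1 - w) / (of_real t * w))"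
        using t by (simp only: of_real_eq_0_iff less_imp_neq[THEN not_sym] not_False_eq_True)
      also have "(1 - w) * (1 - w) = - (of_real t * (of_real u)\<^sup>2)"
        by (simp add: w2 power2_eq_square algebra_simps sqt [symmetric])
      also have "of_real (pi\<^sup>2 / 4) * (- (of_real t * (of_real u)\<^sup>2) / (of_real t * w)) = - of_real (pi\<^sup>2 * u\<^sup>2 / 4) * (1 / w)"
        using t w(1) by simp
      finally show ?thesis .
    qed
    have denominator: "cubic_gf (exp (- of_real t)) = exp (of_real (log_euler_real t + log_euler_real (2 * t)))"
      by (simp only: cubic_gf_exp_of_real[OF t(1)] exp_of_real)
    have "scaled_integrand t u = exp (log_euler (exp (- s t)) + log_euler (exp (- (2 * s t))))
        / exp (of_real (log_euler_real t + log_euler_real (2 * t))) * exp (\<i> * of_real (- (pi\<^sup>2 / (4 * t\<^sup>2) * \<theta> t)))"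
      unfolding scaled_integrand_def Let_def \<theta>_def [symmetric] Complex_minus_eq s_def [symmetric]
        ind denominator cubic_gf_exp[of "s t"] cis_conv_exp by simp
    also have "\<dots> = exp (log_euler (exp (- s t)) + log_euler (exp (- (2 * s t)))
        - of_real (log_euler_real t + log_euler_real (2 * t)) + \<i> * of_real (- (pi\<^sup>2 / (4 * t\<^sup>2) * \<theta> t)))"
      by (simp only: exp_add exp_diff)
    also have "\<dots> = exp (err t + - of_real (pi\<^sup>2 * u\<^sup>2 / 4) * (1 / w))"
      unfolding phase [symmetric] err_def by (rule arg_cong[where f = exp]) simp
    finally show ?case by (simp only: w_def)
  qed
  ultimately show ?thesis by (simp only:) (rule Lim_transform_eventually)
qed

text \<open>
  Termwise, \<open>Re (z ^ m / (1 - z ^ m))\<close> is at most its value at \<open>\<bar>z\<bar>\<close>. Keeping the defect of the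
  first term only is enough for the decay away from the real axis.
\<close>

lemma Re_log_euler_le:
  assumes "norm z < 1"
  defines "r \<equiv> complex_of_real (norm z)"
  shows "Re (log_euler z) - Re (log_euler r) \<le> Re (z / (1 - z)) - Re (r / (1 - r))"
proof -
  define d where "d m = Re (r ^ Suc m / (1 - r ^ Suc m) / of_nat (Suc m)) - Re (z ^ Suc m / (1 - z ^ Suc m) / of_nat (Suc m))" for m
  have r: "norm r < 1" using assms by simp
  have "d sums (Re (log_euler r) - Re (log_euler z))"
    unfolding d_def by (intro sums_diff sums_Re log_euler_sums assms r)
  moreover have nonneg: "d m \<ge> 0" for m
  proof -
    define q where "q = norm z ^ Suc m"
    have q: "0 \<le> q" "q < 1" using norm_power_Suc_less_1[OF assms(1), of m] by (auto simp: q_def norm_power norm_mult)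
    have "Re (z ^ Suc m / (1 - z ^ Suc m)) \<le> norm (z ^ Suc m / (1 - z ^ Suc m))" by (rule complex_Re_le_cmod)
    also have "\<dots> = q / norm (1 - z ^ Suc m)" by (simp only: norm_divide norm_power q_def)
    also have "\<dots> \<le> q / (1 - q)"
      using norm_triangle_ineq2[of 1 "z ^ Suc m"] q by (intro divide_left_mono) (auto simp: q_def norm_power norm_mult intro!: mult_pos_pos)
    also have "\<dots> = Re (r ^ Suc m / (1 - r ^ Suc m))"
    proof -
      have "r ^ Suc m / (1 - r ^ Suc m) = of_real (q / (1 - q))" by (simp add: r_def q_def)
      then show ?thesis by (simp only: Re_complex_of_real)
    qed
    finally have "Re (z ^ Suc m / (1 - z ^ Suc m)) / real (Suc m) \<le> Re (r ^ Suc m / (1 - r ^ Suc m)) / real (Suc m)"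
      by (intro divide_right_mono) auto
    moreover have "Re (w / of_nat (Suc m)) = Re w / real (Suc m)" for w
      by (rule Re_divide_of_nat)
    ultimately show ?thesis by (simp only: d_def diff_ge_0_iff_ge)
  qed
  ultimately have "sum d {0} \<le> Re (log_euler r) - Re (log_euler z)"
    by (metis finite.emptyI finite.insertI sum_le_suminf sums_iff)
  then show ?thesis by (simp add: d_def)
qed

lemma norm_cubic_gf_le:
  assumes "t > 0"
  shows "norm (cubic_gf (exp (Complex (- t) \<theta>))) \<le> norm (cubic_gf (exp (- of_real t))) *
     exp (Re (exp (Complex (- t) \<theta>) / (1 - exp (Complex (- t) \<theta>))) - exp (- t) / (1 - exp (- t)))"
proof -
  define z where "z = exp (Complex (- t) \<theta>)"
  have nz: "norm z = exp (- t)" by (simp add: z_def)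
  have z: "norm z < 1" "norm (z\<^sup>2) < 1"
    using assms by (auto simp: nz norm_power power_less_one_iff)
  have r: "complex_of_real (norm z) = exp (- of_real t)" by (simp add: nz exp_of_real [symmetric])
  have r2: "complex_of_real (norm (z\<^sup>2)) = (exp (- of_real t))\<^sup>2" by (simp only: norm_power of_real_power r)
  have "Re (z\<^sup>2 / (1 - z\<^sup>2)) \<le> Re (of_real (norm (z\<^sup>2)) / (1 - of_real (norm (z\<^sup>2))))"
  proof -
    have "Re (z\<^sup>2 / (1 - z\<^sup>2)) \<le> norm (z\<^sup>2) / norm (1 - z\<^sup>2)"
      using complex_Re_le_cmod[of "z\<^sup>2 / (1 - z\<^sup>2)"] by (simp only: norm_divide)
    also have "\<dots> \<le> norm (z\<^sup>2) / (1 - norm (z\<^sup>2))"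
      using norm_triangle_ineq2[of 1 "z\<^sup>2"] z(2) by (intro frac_le) auto
    also have "\<dots> = Re (of_real (norm (z\<^sup>2) / (1 - norm (z\<^sup>2))))" by (simp only: Re_complex_of_real)
    finally show ?thesis by simp
  qed
  then have 2: "Re (log_euler (z\<^sup>2)) \<le> Re (log_euler ((exp (- of_real t))\<^sup>2))"
    using Re_log_euler_le[OF z(2)] unfolding r2 by linarith
  have "Re (of_real (norm z) / (1 - of_real (norm z))) = Re (of_real (exp (- t) / (1 - exp (- t))))"
    by (simp add: nz)
  then have "Re (of_real (norm z) / (1 - of_real (norm z))) = exp (- t) / (1 - exp (- t))"
    by (simp only: Re_complex_of_real)
  then have 1: "Re (log_euler z) \<le> Re (log_euler (exp (- of_real t))) + (Re (z / (1 - z)) - exp (- t) / (1 - exp (- t)))"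
    using Re_log_euler_le[OF z(1)] unfolding r by linarith
  show ?thesis
    unfolding z_def [symmetric] cubic_gf_def norm_exp_eq_Re exp_add [symmetric]
    using 1 2 by simp
qed

text \<open>
  From the Taylor polynomial of degree 4, as \<open>1 / 2 - pi\<^sup>2 / 24 > 1 / 12\<close>.
\<close>

lemma one_minus_cos_ge:
  assumes "\<bar>\<theta>\<bar> \<le> pi"
  shows "\<theta>\<^sup>2 / 12 \<le> 1 - cos \<theta>"
proof -
  obtain x where "cos \<theta> = (\<Sum>m<4. cos_coeff m * \<theta> ^ m) + cos (x + 1 / 2 * real 4 * pi) / fact 4 * \<theta> ^ 4"
    using Maclaurin_cos_expansion[of \<theta> 4] by blast
  also have "(\<Sum>m<4. cos_coeff m * \<theta> ^ m) = 1 - \<theta>\<^sup>2 / 2"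
  proof -
    have "{..<4} = {0, 1, 2, 3 :: nat}" by auto
    then show ?thesis by (simp add: cos_coeff_def)
  qed
  also have "cos (x + 1 / 2 * real 4 * pi) / fact 4 * \<theta> ^ 4 \<le> 1 / 24 * \<theta> ^ 4"
    by (intro mult_right_mono) (auto simp: fact_numeral)
  also have "1 / 24 * \<theta> ^ 4 \<le> 10 / 24 * \<theta>\<^sup>2"
  proof -
    have "\<theta>\<^sup>2 \<le> pi\<^sup>2" using assms by (simp add: abs_le_square_iff [symmetric])
    also have "\<dots> \<le> 3.15\<^sup>2" using pi_approx by (intro power_mono) auto
    also have "\<dots> \<le> 10" by (simp add: power2_eq_square)
    finally have "\<theta>\<^sup>2 * \<theta>\<^sup>2 \<le> 10 * \<theta>\<^sup>2" by (intro mult_right_mono) auto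
    then show ?thesis by (simp add: power4_eq_xxxx power2_eq_square)
  qed
  finally show ?thesis by simp
qed

text \<open>
  With \<open>q = exp (- t)\<close> and \<open>\<delta> = 1 - cos \<theta>\<close>, the left-hand side of the inequality equals
  \<open>(1 + q) * (q * \<delta>) / ((1 - q) * ((1 - q)\<^sup>2 + 2 * (q * \<delta>)))\<close>. This increases with \<open>q * \<delta>\<close>, so a lower
  bound for \<open>q * \<delta>\<close> may be inserted.
\<close>

lemma geometric_decay_bound:
  assumes t: "0 < t" "t \<le> 1 / 2" and \<theta>: "\<bar>\<theta>\<bar> \<le> pi"
  shows "exp (- t) / (1 - exp (- t)) - Re (exp (Complex (- t) \<theta>) / (1 - exp (Complex (- t) \<theta>)))
    \<ge> (\<theta>\<^sup>2 / 24) / (t * (t\<^sup>2 + \<theta>\<^sup>2 / 12))"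
proof -
  define q where "q = exp (- t)"
  define \<delta> where "\<delta> = 1 - cos \<theta>"
  have q: "0 < q" "q < 1" "1 - q \<le> t"
    using t exp_ge_add_one_self[of "- t"] by (auto simp: q_def)
  have q2: "1 / 2 \<le> q" using q t by linarith
  have \<delta>: "\<theta>\<^sup>2 / 12 \<le> \<delta>" unfolding \<delta>_def by (rule one_minus_cos_ge[OF \<theta>])
  then have \<delta>0: "0 \<le> \<delta>" using zero_le_power2[of \<theta>] by linarith
  define D where "D = (1 - q)\<^sup>2 + 2 * (q * \<delta>)"
  have D: "D > 0" unfolding D_def using q \<delta>0 by (intro add_pos_nonneg) auto
  define z where "z = exp (Complex (- t) \<theta>)"
  have z: "Re z = q * cos \<theta>" "Im z = q * sin \<theta>" by (auto simp: z_def q_def Re_exp Im_exp)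
  have "(1 - Re z)\<^sup>2 + (Im z)\<^sup>2 = 1 - 2 * q * cos \<theta> + q\<^sup>2 * ((cos \<theta>)\<^sup>2 + (sin \<theta>)\<^sup>2)"
    unfolding z power2_eq_square by (simp only: algebra_simps)
  then have den: "(1 - Re z)\<^sup>2 + (Im z)\<^sup>2 = D"
    by (simp add: D_def \<delta>_def power2_eq_square algebra_simps)
  have n1: "1 - z \<noteq> 0"
  proof
    assume "1 - z = 0"
    then have "Re z = 1" "Im z = 0" by (auto simp: complex_eq_iff)
    then show False using den D by simp
  qed
  have "z / (1 - z) = 1 / (1 - z) - 1" using n1 by (simp add: field_simps)
  then have "Re (z / (1 - z)) = (1 - Re z) / D - 1"
    using den by (simp add: Re_divide)
  moreover have "q / (1 - q) = 1 / (1 - q) - 1" using q by (simp add: field_simps)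
  ultimately have "q / (1 - q) - Re (z / (1 - z)) = 1 / (1 - q) - (1 - q + q * \<delta>) / D"
    by (simp add: z \<delta>_def algebra_simps)
  also have "\<dots> = (1 + q) * (q * \<delta>) / ((1 - q) * D)"
    using q D by (simp add: field_simps) (simp add: D_def power2_eq_square algebra_simps)
  finally have E: "q / (1 - q) - Re (z / (1 - z)) = (1 + q) * (q * \<delta>) / ((1 - q) * D)" .
  define y where "y = q * \<delta>"
  have y: "\<theta>\<^sup>2 / 24 \<le> y"
    using mult_mono[OF q2 \<delta>] \<delta>0 q by (simp add: y_def)
  have y0: "0 \<le> \<theta>\<^sup>2 / 24" by simp
  have y1: "0 \<le> y" using y0 y by (rule order_trans)
  have "(\<theta>\<^sup>2 / 24) / (t * (t\<^sup>2 + \<theta>\<^sup>2 / 12)) = (\<theta>\<^sup>2 / 24) / (t\<^sup>2 + 2 * (\<theta>\<^sup>2 / 24)) / t" by simp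
  also have "\<dots> \<le> y / (t\<^sup>2 + 2 * y) / t"
  proof (rule divide_right_mono)
    define x where "x = \<theta>\<^sup>2 / 24"
    have "x * t\<^sup>2 \<le> y * t\<^sup>2" using y by (intro mult_right_mono) (auto simp: x_def)
    moreover have "t\<^sup>2 + 2 * x > 0" "t\<^sup>2 + 2 * y > 0" using t y1 by (auto simp: x_def intro!: add_pos_nonneg)
    ultimately show "(\<theta>\<^sup>2 / 24) / (t\<^sup>2 + 2 * (\<theta>\<^sup>2 / 24)) \<le> y / (t\<^sup>2 + 2 * y)"
      unfolding x_def [symmetric] by (simp add: divide_le_eq_numeral divide_simps) (simp add: algebra_simps)
  qed (use t in auto)
  also have "\<dots> = y / (t * (t\<^sup>2 + 2 * y))" by simp
  also have "\<dots> \<le> ((1 + q) * y) / ((1 - q) * D)"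
  proof (rule frac_le)
    show "0 \<le> (1 + q) * y" using q y1 by (intro mult_nonneg_nonneg) auto
    show "y \<le> (1 + q) * y" using q y1 by (simp add: algebra_simps)
    show "0 < (1 - q) * D" using q D by simp
    have "D \<le> t\<^sup>2 + 2 * y" unfolding D_def y_def [symmetric] using q by (intro add_mono power_mono) auto
    then show "(1 - q) * D \<le> t * (t\<^sup>2 + 2 * y)"
      using q t D by (intro mult_mono) auto
  qed
  finally show ?thesis using E by (simp only: y_def q_def z_def)
qed

lemma exp_minus_le_cubic:
  assumes "(E :: real) > 0" shows "exp (- E) \<le> 27 / E ^ 3"
proof -
  have "(E / 3) ^ 3 \<le> (1 + E / 3) ^ 3" using assms by (intro power_mono) auto
  also have "\<dots> \<le> exp E" using exp_ge_one_plus_x_over_n_power_n[of 3 E] assms by simp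
  finally have "E ^ 3 / 27 \<le> exp E" by (simp add: power_divide)
  then have "inverse (exp E) \<le> inverse (E ^ 3 / 27)" using assms by (intro le_imp_inverse_le) auto
  then show ?thesis by (simp add: exp_minus)
qed

text \<open>
  Here \<open>v\<close> is \<open>u\<^sup>2\<close>, and \<open>t ^ 3 * v = \<theta>\<^sup>2\<close> is at most 10 because \<open>\<bar>\<theta>\<bar> \<le> pi\<close>. For large \<open>v\<close> this
  bounds \<open>t * v\<close> by a multiple of \<open>v powr (2 / 3)\<close>, so that the exponent is, in absolute value, at
  least of order \<open>v powr (1 / 3)\<close>; the cube of this is of order \<open>v\<close>.
\<close>

lemma exp_scaled_decay_le:
  fixes t v :: real
  assumes t: "0 < t" and v: "0 \<le> v" "t ^ 3 * v \<le> 10"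
  shows "exp (- (v / (24 + 2 * t * v))) \<le> 10 ^ 7 / (1 + v)"
proof (cases "v \<le> 1")
  case True
  have "exp (- (v / (24 + 2 * t * v))) \<le> 1" using t v by simp
  also have "\<dots> \<le> 10 ^ 7 / (1 + v)" using True v by simp
  finally show ?thesis .
next
  case False
  define b where "b = 2 * t * v"
  have b: "b \<ge> 0" using t v by (simp add: b_def)
  \<comment> \<open>The inequality between the arithmetic and the cubic mean of 24 and \<open>b\<close>.\<close>
  have cube: "(24 + b) ^ 3 \<le> 4 * (24 ^ 3 + b ^ 3)"
  proof -
    have "4 * (24 ^ 3 + b ^ 3) - (24 + b) ^ 3 = 3 * (24 + b) * (24 - b)\<^sup>2"
      by (simp add: power3_eq_cube power2_eq_square algebra_simps)
    moreover have "0 \<le> 3 * (24 + b) * (24 - b)\<^sup>2" using b by simp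
    ultimately show ?thesis by linarith
  qed
  have "b ^ 3 = 8 * (t ^ 3 * v) * v\<^sup>2" by (simp add: b_def power3_eq_cube power2_eq_square)
  also have "\<dots> \<le> 8 * 10 * v\<^sup>2"
    by (intro mult_right_mono mult_left_mono v) auto
  finally have b3: "b ^ 3 \<le> 80 * v\<^sup>2" by simp
  have v2: "1 \<le> v\<^sup>2" using False by simp
  have "(24 + b) ^ 3 \<le> 60000 * v\<^sup>2" using cube b3 v2 by simp
  define E where "E = v / (24 + b)"
  have E: "E > 0" using False b by (simp add: E_def)
  have "exp (- E) \<le> 27 / E ^ 3" by (rule exp_minus_le_cubic[OF E])
  also have "\<dots> = 27 * (24 + b) ^ 3 / v ^ 3" by (simp add: E_def power_divide)
  also have "\<dots> \<le> 27 * (60000 * v\<^sup>2) / v ^ 3"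
    using \<open>(24 + b) ^ 3 \<le> 60000 * v\<^sup>2\<close> False by (intro divide_right_mono mult_left_mono) auto
  also have "\<dots> = 1620000 / v" using False by (simp add: power3_eq_cube power2_eq_square)
  also have "\<dots> \<le> 10 ^ 7 / (1 + v)" using False by (simp add: field_simps)
  finally show ?thesis by (simp add: E_def b_def)
qed

text \<open>
  An integrable majorant that does not depend on \<open>t\<close>.
\<close>

lemma norm_scaled_integrand_le:
  assumes t: "0 < t" "t \<le> 1 / 2"
  shows "norm (scaled_integrand t u) \<le> 10 ^ 7 * inverse (1 + u\<^sup>2)"
proof (cases "\<bar>t * sqrt t * u\<bar> \<le> pi")
  case False
  then have "scaled_integrand t u = 0" by (auto simp: scaled_integrand_def Let_def indicator_def abs_le_iff)
  then show ?thesis by (simp add: add_nonneg_nonneg)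
next
  case True
  define \<theta> where "\<theta> = t * sqrt t * u"
  have \<theta>2: "\<theta>\<^sup>2 = t ^ 3 * u\<^sup>2" using t by (simp add: \<theta>_def power_mult_distrib power3_eq_cube power2_eq_square)
  have "\<theta>\<^sup>2 \<le> pi\<^sup>2" using True by (simp add: abs_le_square_iff [symmetric] \<theta>_def)
  also have "\<dots> \<le> 3.15\<^sup>2" using pi_approx by (intro power_mono) auto
  also have "\<dots> \<le> 10" by (simp add: power2_eq_square)
  finally have 10: "t ^ 3 * u\<^sup>2 \<le> 10" by (simp only: \<theta>2)
  define A where "A = norm (cubic_gf (exp (- complex_of_real t)))"
  have A: "A > 0" by (simp add: A_def cubic_gf_def)
  have ind: "norm (indicator {-pi..pi} \<theta> :: real) \<le> 1" by (simp add: indicator_def)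
  have "norm (scaled_integrand t u) = norm (indicator {-pi..pi} \<theta> :: real) * (norm (cubic_gf (exp (Complex (- t) \<theta>))) / A)"
    by (simp add: scaled_integrand_def Let_def \<theta>_def [symmetric] norm_mult norm_divide A_def)
  also have "\<dots> \<le> 1 * (norm (cubic_gf (exp (Complex (- t) \<theta>))) / A)"
    using ind A by (intro mult_right_mono) auto
  also have "\<dots> \<le> A * exp (Re (exp (Complex (- t) \<theta>) / (1 - exp (Complex (- t) \<theta>))) - exp (- t) / (1 - exp (- t))) / A"
    using norm_cubic_gf_le[OF t(1), of \<theta>] A unfolding A_def [symmetric] by (simp only: mult_1 divide_right_mono less_imp_le)
  also have "\<dots> \<le> exp (- ((\<theta>\<^sup>2 / 24) / (t * (t\<^sup>2 + \<theta>\<^sup>2 / 12))))"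
    using geometric_decay_bound[OF t, of \<theta>] True A by (simp add: \<theta>_def)
  also have "(\<theta>\<^sup>2 / 24) / (t * (t\<^sup>2 + \<theta>\<^sup>2 / 12)) = u\<^sup>2 / (24 + 2 * t * u\<^sup>2)"
  proof -
    have "t * (t\<^sup>2 + \<theta>\<^sup>2 / 12) = t ^ 3 * (1 + t * u\<^sup>2 / 12)"
      unfolding \<theta>2 by (simp add: power3_eq_cube power2_eq_square algebra_simps)
    then have "(\<theta>\<^sup>2 / 24) / (t * (t\<^sup>2 + \<theta>\<^sup>2 / 12)) = (t ^ 3 * u\<^sup>2 / 24) / (t ^ 3 * (1 + t * u\<^sup>2 / 12))"
      by (simp only: \<theta>2)
    also have "\<dots> = (u\<^sup>2 / 24) / (1 + t * u\<^sup>2 / 12)" using t by simp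
    also have "\<dots> = u\<^sup>2 / (24 * (1 + t * u\<^sup>2 / 12))" by simp
    also have "24 * (1 + t * u\<^sup>2 / 12) = 24 + 2 * t * u\<^sup>2" by simp
    finally show ?thesis .
  qed
  also have "exp (- (u\<^sup>2 / (24 + 2 * t * u\<^sup>2))) \<le> 10 ^ 7 / (1 + u\<^sup>2)"
    by (rule exp_scaled_decay_le) (use t 10 in auto)
  finally show ?thesis by (simp add: divide_inverse)
qed

section \<open>The saddle point\<close>

lemma exp_Complex_power: "exp (Complex (- t) \<theta>) ^ k = of_real (exp (- t) ^ k) * cis (real k * \<theta>)"
proof -
  have "exp (Complex (- t) \<theta>) = of_real (exp (- t)) * cis \<theta>"
    by (simp add: complex_eq_iff Re_exp Im_exp)
  then show ?thesis by (simp only: power_mult_distrib Complex.DeMoivre of_real_power)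
qed

lemma integral_cis:
  fixes j :: int
  shows "(\<integral>\<theta>. indicator {-pi..pi} \<theta> *\<^sub>R cis (of_int j * \<theta>) \<partial>lborel) = (if j = 0 then 2 * pi else 0)"
proof (cases "j = 0")
  case True
  have "(\<integral>\<theta>. indicator {-pi..pi} \<theta> *\<^sub>R (1 :: complex) \<partial>lborel) = of_real pi - of_real (- pi)"
    by (rule integral_FTC_Icc) (auto intro!: derivative_eq_intros continuous_intros has_vector_derivative_of_real)
  then show ?thesis using True by simp
next
  case False
  define F where "F = (\<lambda>\<theta>. cis (of_int j * \<theta>) / (\<i> * of_int j))"
  have "(\<integral>\<theta>. indicator {-pi..pi} \<theta> *\<^sub>R cis (of_int j * \<theta>) \<partial>lborel) = F pi - F (- pi)"
  proof (rule integral_FTC_Icc)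
    fix x :: real
    have "((\<lambda>z. exp (c * z) / c) has_field_derivative exp (c * z)) (at z)" if "c \<noteq> 0" for c z :: complex
      using that by (auto intro!: derivative_eq_intros)
    from this[of "\<i> * of_int j" "of_real x"]
    have "((\<lambda>z. exp (\<i> * (of_int j * z)) / (\<i> * of_int j)) has_field_derivative exp (\<i> * (of_int j * of_real x))) (at (of_real x))"
      using False by (simp add: mult.assoc)
    then have "((\<lambda>x. exp (\<i> * (of_int j * of_real x)) / (\<i> * of_int j)) has_vector_derivative exp (\<i> * (of_int j * of_real x))) (at x)"
      by (rule has_vector_derivative_real_field)
    then show "(F has_vector_derivative cis (of_int j * x)) (at x within {-pi..pi})"
      by (simp add: F_def cis_conv_exp has_vector_derivative_at_within)
  qed (auto intro!: continuous_intros simp: cis_conv_exp)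
  also have "F pi - F (- pi) = (cis (of_int j * pi) - cis (- (of_int j * pi))) / (\<i> * of_int j)"
    by (simp add: F_def diff_divide_distrib)
  also have "cis (of_int j * pi) - cis (- (of_int j * pi)) = 0"
    by (simp add: complex_eq_iff sin_integer_2pi mult.commute sin_npi_int)
  finally show ?thesis using False by simp
qed

text \<open>
  Cauchy's formula, obtained by integrating the power series termwise and using the orthogonality of
  the characters of the circle.
\<close>

lemma coefficient_integral:
  fixes t :: real and n :: nat
  assumes "t > 0"
  defines "f \<equiv> \<lambda>\<theta>. indicator {-pi..pi} \<theta> *\<^sub>R (cubic_gf (exp (Complex (- t) \<theta>)) * cis (- (real n * \<theta>)))"
  shows "integrable lborel f"
    and "integral\<^sup>L lborel f = 2 * pi * cubic_partition n * exp (- t) ^ n"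
proof -
  define a where "a k = cubic_partition k * exp (- t) ^ k" for k
  define g where "g k \<theta> = indicator {-pi..pi} \<theta> *\<^sub>R (of_real (a k) * cis (of_int (int k - int n) * \<theta>))" for k \<theta>
  have a: "a k \<ge> 0" "summable a" for k
    using assms(1) cubic_partition_summable[of "exp (- t)"]
    by (auto simp: a_def [abs_def] cubic_partition_nonneg)
  have g_eq: "g k \<theta> = of_real (a k) * (indicator {-pi..pi} \<theta> *\<^sub>R cis (of_int (int k - int n) * \<theta>))" for k \<theta>
    by (simp add: g_def)
  have int0: "integrable lborel (\<lambda>\<theta>. indicator {-pi..pi} \<theta> *\<^sub>R cis (of_int j * \<theta>))" for j
    by (rule borel_integrable_compact) (auto intro!: continuous_intros simp: cis_conv_exp)
  have int: "integrable lborel (g k)" for k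
    unfolding g_eq by (intro integrable_mult_right int0)
  have gf: "(\<lambda>k. g k \<theta>) sums f \<theta>" for \<theta>
  proof -
    have "(\<lambda>k. of_real (cubic_partition k) * exp (Complex (- t) \<theta>) ^ k) sums cubic_gf (exp (Complex (- t) \<theta>))"
      by (rule cubic_partition_sums_gf) (use assms in simp)
    then have "(\<lambda>k. indicator {-pi..pi} \<theta> *\<^sub>R (of_real (cubic_partition k) * exp (Complex (- t) \<theta>) ^ k * cis (- (real n * \<theta>)))) sums f \<theta>"
      unfolding f_def by (intro sums_scaleR_right sums_mult2)
    moreover have "of_real (cubic_partition k) * exp (Complex (- t) \<theta>) ^ k * cis (- (real n * \<theta>))
        = of_real (a k) * cis (of_int (int k - int n) * \<theta>)" for k
      by (simp add: exp_Complex_power a_def cis_mult algebra_simps)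
    ultimately show ?thesis by (simp only: g_def)
  qed
  have norm_g: "norm (g k \<theta>) = a k * indicator {-pi..pi} \<theta>" for k \<theta>
    using a(1)[of k] by (simp add: g_def norm_mult)
  have sn: "summable (\<lambda>k. norm (g k \<theta>))" for \<theta>
    unfolding norm_g by (intro summable_mult2 a)
  have "(\<integral>\<theta>. norm (g k \<theta>) \<partial>lborel) = a k * (2 * pi)" for k
    unfolding norm_g by simp
  then have si: "summable (\<lambda>k. \<integral>\<theta>. norm (g k \<theta>) \<partial>lborel)"
    using summable_mult2[OF a(2)] by simp
  have f: "f = (\<lambda>\<theta>. \<Sum>k. g k \<theta>)" using gf by (auto simp: sums_iff)
  show "integrable lborel f"
    unfolding f by (rule integrable_suminf) (use int sn si in auto)
  have "(\<lambda>k. integral\<^sup>L lborel (g k)) sums integral\<^sup>L lborel f"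
    unfolding f by (rule sums_integral) (use int sn si in auto)
  moreover have "integral\<^sup>L lborel (g k) = (if k = n then complex_of_real (a n * (2 * pi)) else 0)" for k
  proof -
    have "integral\<^sup>L lborel (g k)
        = of_real (a k) * (\<integral>\<theta>. indicator {-pi..pi} \<theta> *\<^sub>R cis (of_int (int k - int n) * \<theta>) \<partial>lborel)"
      unfolding g_eq by (rule integral_mult_right_zero)
    then show ?thesis unfolding integral_cis by simp
  qed
  ultimately have "(\<lambda>k. if k = n then complex_of_real (a n * (2 * pi)) else 0) sums integral\<^sup>L lborel f" by simp
  then have "integral\<^sup>L lborel f = complex_of_real (a n * (2 * pi))"
    by (rule sums_unique2) (rule sums_single[of n "\<lambda>k. complex_of_real (a n * (2 * pi))"])
  then show "integral\<^sup>L lborel f = 2 * pi * cubic_partition n * exp (- t) ^ n"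
    by (simp add: a_def)
qed

lemma cubic_partition_eq_integral:
  fixes n :: nat
  assumes "n > 0"
  defines "t \<equiv> pi / (2 * sqrt n)"
  shows "integrable lborel (scaled_integrand t)"
    and "of_real (cubic_partition n) = of_real (t * sqrt t / (2 * pi) * exp (real n * t + log_euler_real t + log_euler_real (2 * t)))
      * integral\<^sup>L lborel (scaled_integrand t)"
proof -
  have t: "t > 0" using assms by (simp add: t_def)
  have n: "pi\<^sup>2 / (4 * t\<^sup>2) = n"
    using assms by (simp add: t_def power_divide power_mult_distrib)
  define c where "c = t * sqrt t"
  have c: "c > 0" using t by (simp add: c_def)
  define A where "A = exp (log_euler_real t + log_euler_real (2 * t))"
  define f where "f = (\<lambda>\<theta>. indicator {-pi..pi} \<theta> *\<^sub>R (cubic_gf (exp (Complex (- t) \<theta>)) * cis (- (real n * \<theta>))))"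
  have f: "integrable lborel f" "integral\<^sup>L lborel f = 2 * pi * cubic_partition n * exp (- t) ^ n"
    using coefficient_integral[OF t, of n] unfolding f_def by auto
  have s: "scaled_integrand t = (\<lambda>u. f (0 + c * u) / of_real A)"
    unfolding scaled_integrand_def n Let_def c_def [symmetric] f_def cubic_gf_exp_of_real[OF t] A_def
    by (simp add: scaleR_conv_of_real)
  show "integrable lborel (scaled_integrand t)"
    unfolding s by (intro integrable_divide lborel_integrable_real_affine f) (use c in auto)
  have "integral\<^sup>L lborel f = \<bar>c\<bar> *\<^sub>R (\<integral>u. f (0 + c * u) \<partial>lborel)"
    by (rule lborel_integral_real_affine) (use c in auto)
  also have "(\<integral>u. f (0 + c * u) \<partial>lborel) = of_real A * integral\<^sup>L lborel (scaled_integrand t)"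
    unfolding s by (simp add: A_def)
  finally have "of_real (cubic_partition n) * of_real (2 * pi * exp (- t) ^ n) = of_real (c * A) * integral\<^sup>L lborel (scaled_integrand t)"
    using f(2) c by (simp add: scaleR_conv_of_real mult_ac)
  then have "of_real (cubic_partition n) = of_real (c * A) * integral\<^sup>L lborel (scaled_integrand t) / of_real (2 * pi * exp (- t) ^ n)"
    by (rule eq_divide_imp[rotated]) simp
  moreover have "of_real (c * A) * J / of_real (2 * pi * inverse E) = of_real (c / (2 * pi) * (E * A)) * J"
    for E :: real and J :: complex
  proof -
    have "c * A / (2 * pi * inverse E) = c / (2 * pi) * (E * A)" by (cases "E = 0") (simp_all add: field_simps)
    moreover have "of_real (c * A) * J / of_real (2 * pi * inverse E) = of_real (c * A / (2 * pi * inverse E)) * J"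
      unfolding of_real_divide by (simp only: times_divide_eq_left)
    ultimately show ?thesis by (simp only:)
  qed
  moreover have "exp (- t) ^ n = inverse (exp (real n * t))"
    by (simp only: exp_of_nat_mult exp_minus power_inverse)
  moreover have "exp (real n * t + log_euler_real t + log_euler_real (2 * t)) = exp (real n * t) * A"
    by (simp only: A_def exp_add mult.assoc)
  ultimately show "of_real (cubic_partition n) = of_real (t * sqrt t / (2 * pi) * exp (real n * t + log_euler_real t + log_euler_real (2 * t)))
      * integral\<^sup>L lborel (scaled_integrand t)"
    by (simp only: c_def [symmetric])
qed

text \<open>
  The integrand is a multiple of the normal density with standard deviation \<open>sqrt 2 / pi\<close>.
\<close>

lemma gaussian_integral:
  "(\<integral>u. exp (- (pi\<^sup>2 * u\<^sup>2 / 4)) \<partial>lborel) = 2 / sqrt pi"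
proof -
  define \<sigma> where "\<sigma> = sqrt 2 / pi"
  have "sqrt (2 * pi * \<sigma>\<^sup>2) = 2 / sqrt pi"
    by (simp add: \<sigma>_def power_divide real_sqrt_divide power2_eq_square real_sqrt_mult)
  then have "exp (- (pi\<^sup>2 * u\<^sup>2 / 4)) = 2 / sqrt pi * normal_density 0 \<sigma> u" for u
    unfolding normal_density_def by (simp add: \<sigma>_def power_divide field_simps)
  then show ?thesis using integral_normal_density[of \<sigma> 0] by (simp add: \<sigma>_def)
qed

lemma saddle_point_at_right: "filterlim (\<lambda>n. pi / (2 * sqrt (real n))) (at_right 0) sequentially"
  using pi_gt_zero by real_asymp

text \<open>
  Dominated convergence along the saddle points. The majorant is valid for \<open>t \<le> 1 / 2\<close>, that is for
  \<open>n \<ge> pi\<^sup>2\<close>; starting at \<open>n = 16\<close> is sufficient, since \<open>pi < 4\<close>.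
\<close>

lemma scaled_integral_tendsto:
  "(\<lambda>n. integral\<^sup>L lborel (scaled_integrand (pi / (2 * sqrt (real n))))) \<longlonglongrightarrow> of_real (2 / sqrt pi)"
proof (rule LIMSEQ_offset[where k = 16])
  let ?t = "\<lambda>n. pi / (2 * sqrt (real (n + 16)))"
  have t: "0 < ?t n" "?t n \<le> 1 / 2" for n
  proof -
    have "sqrt 16 \<le> sqrt (real (n + 16))" by (intro real_sqrt_le_mono) simp
    moreover have "sqrt 16 = (4 :: real)" by (rule real_sqrt_unique) auto
    ultimately have "pi \<le> sqrt (real (n + 16))" using pi_less_4 by linarith
    then show "0 < ?t n" "?t n \<le> 1 / 2" by (auto simp: field_simps)
  qed
  have lim: "filterlim ?t (at_right 0) sequentially"
    using filterlim_compose[OF saddle_point_at_right filterlim_add_const_nat_at_top[of 16]] by simp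
  have "(\<lambda>n. integral\<^sup>L lborel (scaled_integrand (?t n))) \<longlonglongrightarrow> (\<integral>u. complex_of_real (exp (- (pi\<^sup>2 * u\<^sup>2 / 4))) \<partial>lborel)"
  proof (rule integral_dominated_convergence[where w = "\<lambda>u. 10 ^ 7 * inverse (1 + u\<^sup>2)"])
    show "scaled_integrand (?t n) \<in> borel_measurable lborel" for n
      using cubic_partition_eq_integral(1)[of "n + 16"] by (intro borel_measurable_integrable) simp
    show "integrable lborel (\<lambda>u. 10 ^ 7 * inverse (1 + u\<^sup>2) :: real)"
      using integrable_inverse_1_plus_square by (simp add: set_integrable_def einterval_eq_UNIV)
    show "AE u in lborel. (\<lambda>n. scaled_integrand (?t n) u) \<longlonglongrightarrow> complex_of_real (exp (- (pi\<^sup>2 * u\<^sup>2 / 4)))"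
      by (intro AE_I2 filterlim_compose[OF scaled_integrand_tendsto lim])
    show "AE u in lborel. norm (scaled_integrand (?t n) u) \<le> 10 ^ 7 * inverse (1 + u\<^sup>2)" for n
      using t by (intro AE_I2 norm_scaled_integrand_le) auto
  qed simp
  then show "(\<lambda>n. integral\<^sup>L lborel (scaled_integrand (?t n))) \<longlonglongrightarrow> of_real (2 / sqrt pi)"
    by (simp add: gaussian_integral)
qed

lemma log_cubic_gf_asymptotics:
  "((\<lambda>t. log_euler_real t + log_euler_real (2 * t) - pi\<^sup>2 / (4 * t) - ln t) \<longlongrightarrow> ln 2 / 2 - ln (2 * pi)) (at_right 0)"
proof -
  have "filterlim (\<lambda>t :: real. 2 * t) (at_right 0) (at_right 0)" by real_asymp
  then have "((\<lambda>t. log_euler_real (2 * t) - pi\<^sup>2 / (6 * (2 * t)) - ln (2 * t) / 2) \<longlongrightarrow> - ln (2 * pi) / 2) (at_right 0)"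
    by (rule filterlim_compose[OF log_euler_real_asymptotics])
  then have "((\<lambda>t. (log_euler_real t - pi\<^sup>2 / (6 * t) - ln t / 2) + (log_euler_real (2 * t) - pi\<^sup>2 / (6 * (2 * t)) - ln (2 * t) / 2) + ln 2 / 2)
      \<longlongrightarrow> - ln (2 * pi) / 2 + - ln (2 * pi) / 2 + ln 2 / 2) (at_right 0)"
    by (intro tendsto_add tendsto_const log_euler_real_asymptotics)
  moreover have "\<forall>\<^sub>F t in at_right 0. (log_euler_real t - pi\<^sup>2 / (6 * t) - ln t / 2) + (log_euler_real (2 * t) - pi\<^sup>2 / (6 * (2 * t)) - ln (2 * t) / 2) + ln 2 / 2
     = log_euler_real t + log_euler_real (2 * t) - pi\<^sup>2 / (4 * t) - ln t"
    using eventually_at_right_less[of "0 :: real"]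
    by eventually_elim (simp add: ln_mult add_divide_distrib diff_divide_distrib)
  ultimately have "((\<lambda>t. log_euler_real t + log_euler_real (2 * t) - pi\<^sup>2 / (4 * t) - ln t) \<longlongrightarrow> - ln (2 * pi) / 2 + - ln (2 * pi) / 2 + ln 2 / 2) (at_right 0)"
    by (rule Lim_transform_eventually)
  then show ?thesis by simp
qed

theorem corollary3p2:
  shows "cubic_partition \<sim>[sequentially]
    (\<lambda>n. exp (pi * sqrt (real n - 1 / 8)) / (8 * (real n - 1 / 8) powr (5 / 4)))"
proof (rule asymp_equivI')
  define t where "t n = pi / (2 * sqrt (real n))" for n
  define W where "W n = log_euler_real (t n) + log_euler_real (2 * t n) - pi\<^sup>2 / (4 * t n) - ln (t n)" for n
  define I where "I n = integral\<^sup>L lborel (scaled_integrand (t n))" for n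
  define T where "T n = exp (pi * sqrt (real n - 1 / 8)) / (8 * (real n - 1 / 8) powr (5 / 4))" for n
  define B where "B n = (pi / (2 * sqrt (real n))) powr (5 / 2) / (2 * pi) * exp (pi * sqrt (real n)) / T n" for n
  have I: "(\<lambda>n. Re (I n)) \<longlonglongrightarrow> 2 / sqrt pi"
    using tendsto_Re[OF scaled_integral_tendsto] unfolding I_def t_def by simp
  have W: "(\<lambda>n. exp (W n)) \<longlonglongrightarrow> exp (ln 2 / 2 - ln (2 * pi))"
    unfolding W_def t_def by (intro tendsto_exp filterlim_compose[OF log_cubic_gf_asymptotics] saddle_point_at_right)
  have B: "B \<longlonglongrightarrow> (pi / 2) powr (5 / 2) * 8 / (2 * pi)"
    unfolding B_def T_def using pi_gt_zero by real_asymp (simp add: field_simps)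
  \<comment> \<open>The three constants come from the prefactor, from the value of the generating function on the real axis and from the Gaussian integral.\<close>
  have "(pi / 2) powr (5 / 2) * 8 / (2 * pi) * exp (ln 2 / 2 - ln (2 * pi)) * (2 / sqrt pi) = 1"
  proof -
    have "(pi / 2) powr (5 / 2) = (pi / 2) powr 2 * (pi / 2) powr (1 / 2)"
      by (simp only: powr_add [symmetric]) simp
    then have p: "(pi / 2) powr (5 / 2) = (pi / 2)\<^sup>2 * (sqrt pi / sqrt 2)"
      by (simp add: powr_half_sqrt real_sqrt_divide powr_numeral)
    have e: "exp (ln 2 / 2 - ln (2 * pi)) = sqrt 2 / (2 * pi)"
      using powr_half_sqrt[of "2 :: real"] by (simp add: exp_diff powr_def)
    show ?thesis unfolding p e by (simp add: field_simps power2_eq_square)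
  qed
  then have "(\<lambda>n. B n * exp (W n) * Re (I n)) \<longlonglongrightarrow> 1"
    using tendsto_mult[OF tendsto_mult[OF B W] I] by simp
  moreover have "\<forall>\<^sub>F n in sequentially. B n * exp (W n) * Re (I n) = cubic_partition n / T n"
    using eventually_gt_at_top[of 0]
  proof eventually_elim
    case (elim n)
    then have t: "t n > 0" by (simp add: t_def)
    have "complex_of_real (cubic_partition n) = of_real (t n * sqrt (t n) / (2 * pi) * exp (real n * t n + log_euler_real (t n) + log_euler_real (2 * t n))) * I n"
      unfolding I_def t_def by (rule cubic_partition_eq_integral(2)[OF elim])
    then have "Re (complex_of_real (cubic_partition n)) = Re (of_real (t n * sqrt (t n) / (2 * pi) * exp (real n * t n + log_euler_real (t n) + log_euler_real (2 * t n))) * I n)"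
      by (rule arg_cong)
    then have a: "cubic_partition n = t n * sqrt (t n) / (2 * pi) * exp (real n * t n + log_euler_real (t n) + log_euler_real (2 * t n)) * Re (I n)"
      by simp
    have "real n * t n = real n / sqrt (real n) * pi / 2"
      by (simp add: t_def)
    then have "real n * t n = pi * sqrt (real n) / 2"
      by (simp add: real_div_sqrt)
    moreover have "pi\<^sup>2 / (4 * t n) = pi * sqrt (real n) / 2"
      using elim by (simp add: t_def power2_eq_square)
    ultimately have "real n * t n + log_euler_real (t n) + log_euler_real (2 * t n) = pi * sqrt (real n) + ln (t n) + W n"
      by (simp add: W_def)
    then have "exp (real n * t n + log_euler_real (t n) + log_euler_real (2 * t n)) = exp (pi * sqrt (real n)) * t n * exp (W n)"
      using t by (simp add: exp_add)
    moreover have "t n * sqrt (t n) * t n = t n powr (5 / 2)"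
    proof -
      have "t n powr (5 / 2) = t n powr 1 * t n powr (1 / 2) * t n powr 1"
        by (simp only: powr_add [symmetric]) simp
      then show ?thesis using t by (simp add: powr_half_sqrt)
    qed
    ultimately have "cubic_partition n = t n powr (5 / 2) / (2 * pi) * exp (pi * sqrt (real n)) * exp (W n) * Re (I n)"
      unfolding a by (simp add: mult_ac)
    then show ?case by (simp add: B_def t_def [symmetric])
  qed
  ultimately show "(\<lambda>n. cubic_partition n / (exp (pi * sqrt (real n - 1 / 8)) / (8 * (real n - 1 / 8) powr (5 / 4)))) \<longlonglongrightarrow> 1"
    unfolding T_def by (rule Lim_transform_eventually)
qed

end
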